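(* Let $\{X(t),\,t\geq 0\}$ be an $(H,\delta)$-dilatively stable process with stationary increments and zero mean such that either $\delta\neq 2H$ or $H>1/2$. Then $\{X(t),\,t\geq 0\}$ has a continuous modification $\{\widetilde X(t),\,t\geq 0\}$, the sample paths of which are locally $\gamma$-Hölder continuous (i) for every $\gamma\in(0,H)$ if $\delta<0$, (ii) for every $\gamma\in(0,H-\delta/2)$ if $0\leq\delta<2H$, (iii) for every $\gamma\in(0,H-1/2)$ if $\delta=2H$ and $H>1/2$. Moreover, assume that, in case $\delta\ge 0$, the distribution of $X(1)$ has a Gaussian component (no requirement in case $\delta<0$). Then for the local Hölder exponent $\Gamma_X$ of the sample paths of the continuous modification $\{\widetilde X(t),\,t\geq 0\}$ of $\{X(t),\,t\geq0\}$ we have, almost surely, ($\widetilde{\mathrm{i}}$) $\Gamma_X=H$ if $\delta<0$, ($\widetilde{\mathrm{ii}}$) $\Gamma_X\in[H-\delta/2,\,H]$ if $0\leq\delta<2H$, ($\widetilde{\mathrm{iii}}$) $\Gamma_X\in[H-1/2,\,H]$ if $\delta=2H$ and $H>1/2$.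
   Context: A process $\{X(t),t\ge0\}$ is real-valued; $\overset{\mathrm{fd}}{\sim}$ denotes equality of all finite-dimensional distributions. For a process $X$ all of whose finite-dimensional distributions are infinitely divisible and for $c>0$, $X^{\circledast c}=\{X(t),t\ge0\}^{\circledast c}$ denotes a process whose finite-dimensional distributions are the $c$-th convolution powers of the corresponding finite-dimensional distributions of $X$ (i.e. characteristic functions are raised to the power $c$). Let $\alpha>0$ and $\delta\leq 2\alpha$. A process $\{X(t),t\ge 0\}$ starting from zero ($X(0)=0$) is called $(\alpha,\delta)$-dilatively stable if its finite-dimensional distributions are infinitely divisible, $X(1)$ is non-Gaussian, $X(t)$ has finite moments of all orders for all $t\ge0$, and for all $T>0$, $X(T\,\cdot\,)\overset{\mathrm{fd}}{\sim}T^{\alpha-\delta/2}X^{\circledast T^\delta}(\,\cdot\,)$. In the stationary increments case the parameter $\alpha$ is denoted by $H$. Stationary increments means that for every $s\ge0$ the processes $\{X(t+s)-X(s),t\ge0\}$ and $\{X(t)-X(0),t\ge0\}$ have the same finite-dimensional distributions. Zero mean means $\mathsf{E}X(t)=0$ for all $t\geq 0$. An infinitely divisible distribution is said to have a Gaussian component if in its Lévy–Khintchine representation the Gaussian part has positive variance. Let $I\subseteq[0,\infty)$ be an interval and $\gamma\in(0,1]$. A function $f:I\to\mathbb{R}$ is locally $\gamma$-Hölder continuous if for every bounded subinterval $J\subseteq I$, $\sup_{t,s\in J,\,t\ne s}|f(t)-f(s)|/|t-s|^\gamma<\infty$. The local Hölder exponent of $f$ is $\Gamma_f=\sup\{\gamma\in(0,1]: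 f\text{ is locally }\gamma\text{-Hölder continuous}\}$, set to $0$ if there is no such $\gamma$. Here $I=[0,\infty)$, and $\Gamma_X$ denotes the (random) local Hölder exponent of the sample path of the continuous modification $\{\widetilde X(t),\,t\geq 0\}$. *)

theory Defs
  imports "HOL-Probability.Probability"
begin

(* A process is a map X :: real => 'a => real of which only the values X t with t >= 0 matter. *)

definition is_process :: "'a measure \<Rightarrow> (real \<Rightarrow> 'a \<Rightarrow> real) \<Rightarrow> bool" where
  "is_process M X \<longleftrightarrow> prob_space M \<and> (\<forall>t\<ge>0. X t \<in> borel_measurable M)"

definition fdd :: "'a measure \<Rightarrow> (real \<Rightarrow> 'a \<Rightarrow> real) \<Rightarrow> real set \<Rightarrow> (real \<Rightarrow> real) measure" where
  "fdd M X J = distr M (Pi\<^sub>M J (\<lambda>_. borel)) (\<lambda>\<omega>. \<lambda>t\<in>J. X t \<omega>)"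

definition fd_equal ::
    "'a measure \<Rightarrow> (real \<Rightarrow> 'a \<Rightarrow> real) \<Rightarrow> 'b measure \<Rightarrow> (real \<Rightarrow> 'b \<Rightarrow> real) \<Rightarrow> bool" where
  "fd_equal M X N Y \<longleftrightarrow> (\<forall>J. finite J \<and> J \<subseteq> {0..} \<longrightarrow> fdd M X J = fdd N Y J)"

(* mu is, for every n >= 1, the law of a sum of n independent vectors with a common law nu. *)
definition infinitely_divisible :: "'i set \<Rightarrow> ('i \<Rightarrow> real) measure \<Rightarrow> bool" where
  "infinitely_divisible J \<mu> \<longleftrightarrow>
     (\<forall>n::nat. 1 \<le> n \<longrightarrow>
        (\<exists>\<nu>. prob_space \<nu> \<and> sets \<nu> = sets (Pi\<^sub>M J (\<lambda>_. borel)) \<and>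
           \<mu> = distr (Pi\<^sub>M {..<n} (\<lambda>_. \<nu>)) (Pi\<^sub>M J (\<lambda>_. borel))
                 (\<lambda>y. \<lambda>i\<in>J. \<Sum>k<n. y k i)))"

definition fd_char :: "'i set \<Rightarrow> ('i \<Rightarrow> real) measure \<Rightarrow> ('i \<Rightarrow> real) \<Rightarrow> complex" where
  "fd_char J \<mu> u = (CLINT x|\<mu>. iexp (\<Sum>i\<in>J. u i * x i))"

(* The c-th power of a characteristic function is formed with its distinguished logarithm psi:
   the continuous logarithm vanishing at 0. As the space of all u is connected, psi is unique;
   that fd_char depends on u only through the coordinates in J does no harm. *)
definition convolution_power ::
    "'i set \<Rightarrow> ('i \<Rightarrow> real) measure \<Rightarrow> real \<Rightarrow> ('i \<Rightarrow> real) measure \<Rightarrow> bool" where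
  "convolution_power J \<mu> c \<nu> \<longleftrightarrow>
     prob_space \<nu> \<and> sets \<nu> = sets (Pi\<^sub>M J (\<lambda>_. borel)) \<and>
     (\<exists>\<psi> :: ('i \<Rightarrow> real) \<Rightarrow> complex. continuous_on UNIV \<psi> \<and> \<psi> (\<lambda>_. 0) = 0 \<and>
        (\<forall>u. fd_char J \<mu> u = exp (\<psi> u)) \<and>
        (\<forall>u. fd_char J \<nu> u = exp (of_real c * \<psi> u)))"

definition process_convolution_power ::
    "'a measure \<Rightarrow> (real \<Rightarrow> 'a \<Rightarrow> real) \<Rightarrow> real \<Rightarrow> 'b measure \<Rightarrow> (real \<Rightarrow> 'b \<Rightarrow> real) \<Rightarrow> bool" where
  "process_convolution_power M X c N Y \<longleftrightarrow>
     is_process N Y \<and>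
     (\<forall>J. finite J \<and> J \<subseteq> {0..} \<longrightarrow> convolution_power J (fdd M X J) c (fdd N Y J))"

(* Point masses count as (degenerate) Gaussian laws. *)
definition gaussian_law :: "real measure \<Rightarrow> bool" where
  "gaussian_law \<mu> \<longleftrightarrow>
     (\<exists>m \<sigma>. \<sigma> > 0 \<and> \<mu> = density lborel (\<lambda>x. ennreal (normal_density m \<sigma> x))) \<or>
     (\<exists>m. \<mu> = return borel m)"

(* A process is determined up to its finite-dimensional distributions by a measure on the path
   space, so that realising the convolution power on (real => real) is no restriction. *)
definition dilatively_stable ::
    "real \<Rightarrow> real \<Rightarrow> 'a measure \<Rightarrow> (real \<Rightarrow> 'a \<Rightarrow> real) \<Rightarrow> bool" where
  "dilatively_stable \<alpha> \<delta> M X \<longleftrightarrow>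
     \<alpha> > 0 \<and> \<delta> \<le> 2 * \<alpha> \<and> is_process M X \<and>
     (AE \<omega> in M. X 0 \<omega> = 0) \<and>
     (\<forall>J. finite J \<and> J \<subseteq> {0..} \<longrightarrow> infinitely_divisible J (fdd M X J)) \<and>
     \<not> gaussian_law (distr M borel (X 1)) \<and>
     (\<forall>t\<ge>0. \<forall>n::nat. integrable M (\<lambda>\<omega>. X t \<omega> ^ n)) \<and>
     (\<forall>T>0. \<exists>(N :: (real \<Rightarrow> real) measure) Y.
        process_convolution_power M X (T powr \<delta>) N Y \<and>
        fd_equal M (\<lambda>t. X (T * t)) N (\<lambda>t \<omega>. T powr (\<alpha> - \<delta> / 2) * Y t \<omega>))"

definition stationary_increments :: "'a measure \<Rightarrow> (real \<Rightarrow> 'a \<Rightarrow> real) \<Rightarrow> bool" where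
  "stationary_increments M X \<longleftrightarrow>
     (\<forall>s\<ge>0. fd_equal M (\<lambda>t \<omega>. X (t + s) \<omega> - X s \<omega>) M (\<lambda>t \<omega>. X t \<omega> - X 0 \<omega>))"

definition zero_mean :: "'a measure \<Rightarrow> (real \<Rightarrow> 'a \<Rightarrow> real) \<Rightarrow> bool" where
  "zero_mean M X \<longleftrightarrow> (\<forall>t\<ge>0. integrable M (X t) \<and> integral\<^sup>L M (X t) = 0)"

definition levy_measure :: "real measure \<Rightarrow> bool" where
  "levy_measure \<Lambda> \<longleftrightarrow>
     sets \<Lambda> = sets borel \<and> emeasure \<Lambda> {0} = 0 \<and>
     (\<integral>\<^sup>+x. ennreal (min 1 (x\<^sup>2)) \<partial>\<Lambda>) < \<infinity>"

(* v is the variance of the Gaussian part. *)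
definition levy_khintchine :: "real measure \<Rightarrow> real \<Rightarrow> real \<Rightarrow> real measure \<Rightarrow> bool" where
  "levy_khintchine \<mu> b v \<Lambda> \<longleftrightarrow>
     v \<ge> 0 \<and> levy_measure \<Lambda> \<and>
     (\<forall>u. char \<mu> u =
        exp (\<i> * of_real (b * u) - of_real (v * u\<^sup>2 / 2) +
             (CLINT x|\<Lambda>. iexp (u * x) - 1 - \<i> * of_real (u * x * indicator {-1..1} x))))"

definition has_gaussian_component :: "real measure \<Rightarrow> bool" where
  "has_gaussian_component \<mu> \<longleftrightarrow> (\<exists>b v \<Lambda>. levy_khintchine \<mu> b v \<Lambda> \<and> v > 0)"

definition continuous_modification ::
    "'a measure \<Rightarrow> (real \<Rightarrow> 'a \<Rightarrow> real) \<Rightarrow> (real \<Rightarrow> 'a \<Rightarrow> real) \<Rightarrow> bool" where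
  "continuous_modification M X Y \<longleftrightarrow>
     is_process M Y \<and> (\<forall>t\<ge>0. AE \<omega> in M. Y t \<omega> = X t \<omega>) \<and>
     (\<forall>\<omega>\<in>space M. continuous_on {0..} (\<lambda>t. Y t \<omega>))"

definition locally_holder_on :: "real set \<Rightarrow> real \<Rightarrow> (real \<Rightarrow> real) \<Rightarrow> bool" where
  "locally_holder_on I \<gamma> f \<longleftrightarrow>
     (\<forall>J. is_interval J \<and> bounded J \<and> J \<subseteq> I \<longrightarrow>
        bdd_above {\<bar>f t - f s\<bar> / \<bar>t - s\<bar> powr \<gamma> | t s. t \<in> J \<and> s \<in> J \<and> t \<noteq> s})"

definition local_holder_exponent :: "real set \<Rightarrow> (real \<Rightarrow> real) \<Rightarrow> real" where
  "local_holder_exponent I f =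
     (let G = {\<gamma>. 0 < \<gamma> \<and> \<gamma> \<le> 1 \<and> locally_holder_on I \<gamma> f}
      in if G = {} then 0 else Sup G)"

end

theory Submission
  imports Defs
begin

text \<open>For \<open>c = T\<^sup>\<delta>\<close>, the variable \<open>X(T) / T\<^bsup>H - \<delta>/2\<^esup>\<close> has characteristic function \<open>exp (c \<psi>)\<close>, where
  \<open>exp \<psi>\<close> is that of \<open>X(1)\<close>. Hence its moments are polynomials in \<open>c\<close> without constant term and,
  since the mean vanishes, of degree at most half the order of the moment. With stationary increments
  this bounds the even moments of \<open>X(t) - X(s)\<close> by powers of \<open>t - s\<close>, and the Kolmogorov-Chentsov
  argument applies, with arbitrarily high moments except for \<open>\<delta> = 2H\<close>, where the second one is best.

  For the upper bound on the Hoelder exponent it suffices that \<open>\<bar>X(t)\<bar> \<le> C t\<^sup>\<gamma>\<close> has probability tending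
  to 0 as \<open>t \<rightarrow> 0\<close> for every \<open>\<gamma> > H\<close>. The characteristic function of \<open>X(t) / t\<^sup>H\<close> is dominated by a
  Gaussian one: on all of the line if \<open>X(1)\<close> has a Gaussian component, and for \<open>\<delta> < 0\<close> on intervals
  growing to the line, because then \<open>c \<rightarrow> \<infinity>\<close> and the situation is that of the central limit theorem.\<close>

subsection \<open>Moments of convolution powers\<close>

text \<open>The logarithm \<psi> is only known to be continuous, and moments of all orders do not
  make the moment series converge. So the relation between \<open>exp \<psi>\<close> and
  \<open>exp (c \<psi>)\<close> is differentiated pointwise and carried over to formal power series,
  where it becomes a recursion for the moments. For small t the power c = t^\<delta> decides which
  end of the moment polynomial matters. If \<delta> < 0, then c is large and the top degree p/2
  dominates: the p-th moment is at most of order t^(p(H-\<delta>/2)) c^(p/2) = t^(pH). If \<delta>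
  \<ge> 0, then c \<le> 1 and a single factor c is all that is gained: t^(p(H-\<delta>/2)+\<delta>).
  Dividing the exponent, less 1, by p and letting p grow gives H and H-\<delta>/2; for \<delta> = 2H
  the exponent is 2H whatever p is. Gaussian domination is compatible with the scaling: raising
  exp(-\<kappa> w^2) to the power c at w = u / sqrt c gives back exp(-\<kappa> u^2). Hence one bound
  for X(1) serves all small times.\<close>

lemma has_vector_derivative_quadratic:
  fixes f :: "real \<Rightarrow> 'a::real_normed_vector"
  assumes "\<And>h. norm (f (u + h) - f u - h *\<^sub>R D) \<le> B * h\<^sup>2"
  shows "(f has_vector_derivative D) (at u)"
proof -
  have "(\<lambda>h. norm (f (u + h) - f u - h *\<^sub>R D) / norm h) \<midarrow>0\<rightarrow> 0"
  proof (rule Lim_null_comparison)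
    show "\<forall>\<^sub>F h in at 0. norm (norm (f (u + h) - f u - h *\<^sub>R D) / norm h) \<le> B * \<bar>h\<bar>"
      unfolding eventually_at_filter
    proof (rule always_eventually, intro allI impI)
      fix h :: real assume "h \<noteq> 0"
      then show "norm (norm (f (u + h) - f u - h *\<^sub>R D) / norm h) \<le> B * \<bar>h\<bar>"
        using assms[of h] by (simp add: divide_le_eq power2_eq_square mult.assoc flip: abs_mult)
    qed
    show "(\<lambda>h. B * \<bar>h\<bar>) \<midarrow>0\<rightarrow> 0"
      by (auto intro!: tendsto_eq_intros)
  qed
  then show ?thesis
    unfolding has_vector_derivative_def has_derivative_at
    by (auto intro: bounded_linear_intros)
qed

text \<open>Formal Taylor expansion with moving base point: differentiating in u acts
  coefficientwise as the formal derivative. No convergence is asked for, so smoothness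
  suffices.\<close>

definition taylor_family :: "(real \<Rightarrow> complex fps) \<Rightarrow> bool" where
  "taylor_family S \<longleftrightarrow>
     (\<forall>n u. ((\<lambda>u. fps_nth (S u) n) has_vector_derivative fps_nth (fps_deriv (S u)) n) (at u))"

lemma taylor_family_mult:
  assumes "taylor_family S" "taylor_family R"
  shows "taylor_family (\<lambda>u. S u * R u)"
  unfolding taylor_family_def
proof (intro allI)
  fix n u
  have "((\<lambda>u. \<Sum>i=0..n. fps_nth (S u) i * fps_nth (R u) (n - i)) has_vector_derivative
     (\<Sum>i=0..n. fps_nth (S u) i * fps_nth (fps_deriv (R u)) (n - i) +
                  fps_nth (fps_deriv (S u)) i * fps_nth (R u) (n - i))) (at u)"
    using assms unfolding taylor_family_def
    by (intro has_vector_derivative_sum has_vector_derivative_mult) blast+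
  then show "((\<lambda>u. fps_nth (S u * R u) n) has_vector_derivative fps_nth (fps_deriv (S u * R u)) n) (at u)"
    by (simp only: fps_mult_nth fps_deriv_mult fps_add_nth sum.distrib)
qed

lemma taylor_family_deriv:
  assumes "taylor_family S"
  shows "taylor_family (\<lambda>u. fps_deriv (S u))"
  unfolding taylor_family_def
proof (intro allI)
  fix n u
  have "((\<lambda>u. of_nat (n + 1) * fps_nth (S u) (n + 1)) has_vector_derivative
      of_nat (n + 1) * fps_nth (fps_deriv (S u)) (n + 1)) (at u)"
    using assms unfolding taylor_family_def by (intro has_vector_derivative_mult_right) blast
  then show "((\<lambda>u. fps_nth (fps_deriv (S u)) n) has_vector_derivative
      fps_nth (fps_deriv (fps_deriv (S u))) n) (at u)"
    by (simp only: fps_deriv_nth)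
qed

lemma taylor_family_const_mult:
  assumes "taylor_family S"
  shows "taylor_family (\<lambda>u. fps_const c * S u)"
  using assms unfolding taylor_family_def
  by (auto intro!: has_vector_derivative_mult_right)

text \<open>The derivative in u of coefficient n is n+1 times coefficient n+1, so equality of the
  constant terms propagates upwards. For this it has to hold at every base point, even if only u = 0
  is of interest.\<close>

lemma taylor_family_eqI:
  assumes "taylor_family S" "taylor_family R" "\<And>u. fps_nth (S u) 0 = fps_nth (R u) 0"
  shows "S u = R u"
proof -
  have "\<forall>u. fps_nth (S u) n = fps_nth (R u) n" for n
  proof (induction n)
    case (Suc n)
    show ?case
    proof
      fix u
      have "((\<lambda>u. fps_nth (S u) n) has_vector_derivative fps_nth (fps_deriv (S u)) n) (at u)"
        using assms(1) unfolding taylor_family_def by blast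
      moreover have "((\<lambda>u. fps_nth (S u) n) has_vector_derivative fps_nth (fps_deriv (R u)) n) (at u)"
        using assms(2) Suc unfolding taylor_family_def by simp
      ultimately have "fps_nth (fps_deriv (S u)) n = fps_nth (fps_deriv (R u)) n"
        by (rule vector_derivative_unique_at)
      then show "fps_nth (S u) (Suc n) = fps_nth (R u) (Suc n)"
        by (simp del: of_nat_Suc)
    qed
  qed (use assms in auto)
  then show ?thesis by (simp add: fps_eq_iff)
qed

text \<open>For Z with moments of all orders this is the Taylor series at u of its characteristic
  function; at u = 0 the coefficients are the moments up to the factors i^n / n!.\<close>

definition char_fps :: "'a measure \<Rightarrow> ('a \<Rightarrow> real) \<Rightarrow> real \<Rightarrow> complex fps" where
  "char_fps M Z u = Abs_fps (\<lambda>n. (CLINT \<omega>|M. (\<i> * Z \<omega>) ^ n * iexp (u * Z \<omega>)) / fact n)"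

section \<open>The moment series of a random variable\<close>

context prob_space
begin

lemma integrable_moment_iexp:
  fixes Z :: "'a \<Rightarrow> real"
  assumes [measurable]: "Z \<in> borel_measurable M" and "integrable M (\<lambda>\<omega>. Z \<omega> ^ n)"
  shows "integrable M (\<lambda>\<omega>. (\<i> * Z \<omega>) ^ n * iexp (u * Z \<omega>))"
  using assms(2) by (rule Bochner_Integration.integrable_bound) (auto simp: norm_mult norm_power power_abs)

text \<open>The first-order Taylor remainder of \<open>iexp\<close> is integrated: the error is at
  most h^2 times the absolute moment of order n+2.\<close>

lemma has_vector_derivative_moment_iexp:
  fixes Z :: "'a \<Rightarrow> real"
  assumes [measurable]: "Z \<in> borel_measurable M" and int: "\<And>n. integrable M (\<lambda>\<omega>. Z \<omega> ^ n)"
  shows "((\<lambda>u. CLINT \<omega>|M. (\<i> * Z \<omega>) ^ n * iexp (u * Z \<omega>)) has_vector_derivative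
          (CLINT \<omega>|M. (\<i> * Z \<omega>) ^ Suc n * iexp (u * Z \<omega>))) (at u)"
proof (rule has_vector_derivative_quadratic)
  fix h :: real
  let ?g = "\<lambda>n u \<omega>. (\<i> * Z \<omega>) ^ n * iexp (u * Z \<omega>)"
  note int' = integrable_moment_iexp[OF assms(1) int]
  have pw: "norm (?g n (u + h) \<omega> - ?g n u \<omega> - h *\<^sub>R ?g (Suc n) u \<omega>) \<le> \<bar>Z \<omega> ^ (n + 2)\<bar> * h\<^sup>2" for \<omega>
  proof -
    have "?g n (u + h) \<omega> - ?g n u \<omega> - h *\<^sub>R ?g (Suc n) u \<omega> =
       ?g n u \<omega> * (iexp (h * Z \<omega>) - (\<Sum>k\<le>1. (\<i> * (h * Z \<omega>)) ^ k / fact k))"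
      by (simp add: scaleR_conv_of_real algebra_simps exp_add)
    then have "norm (?g n (u + h) \<omega> - ?g n u \<omega> - h *\<^sub>R ?g (Suc n) u \<omega>) =
       \<bar>Z \<omega>\<bar> ^ n * cmod (iexp (h * Z \<omega>) - (\<Sum>k\<le>1. (\<i> * (h * Z \<omega>)) ^ k / fact k))"
      by (simp add: norm_mult norm_power)
    also have "\<dots> \<le> \<bar>Z \<omega>\<bar> ^ n * (\<bar>h * Z \<omega>\<bar> ^ 2 / 2)"
      using iexp_approx1[of "h * Z \<omega>" 1]
      by (intro mult_left_mono) (auto simp: numeral_2_eq_2)
    also have "\<dots> = \<bar>Z \<omega> ^ (n + 2)\<bar> * h\<^sup>2 / 2"
      by (simp add: power_add abs_mult power_mult_distrib power_abs power2_eq_square)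
    also have "\<dots> \<le> \<bar>Z \<omega> ^ (n + 2)\<bar> * h\<^sup>2"
      by simp
    finally show ?thesis .
  qed
  have "(CLINT \<omega>|M. ?g n (u + h) \<omega>) - (CLINT \<omega>|M. ?g n u \<omega>) - h *\<^sub>R (CLINT \<omega>|M. ?g (Suc n) u \<omega>)
     = (CLINT \<omega>|M. ?g n (u + h) \<omega> - ?g n u \<omega> - h *\<^sub>R ?g (Suc n) u \<omega>)"
    by (subst Bochner_Integration.integral_diff, (intro Bochner_Integration.integrable_diff integrable_scaleR_right int')+)
      (simp only: Bochner_Integration.integral_diff[OF int' int'] integral_scaleR_right)
  also have "norm \<dots> \<le> (\<integral>\<omega>. \<bar>Z \<omega> ^ (n + 2)\<bar> * h\<^sup>2 \<partial>M)"
  proof (rule order_trans[OF integral_norm_bound integral_mono'])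
    show "integrable M (\<lambda>\<omega>. \<bar>Z \<omega> ^ (n + 2)\<bar> * h\<^sup>2)"
      by (intro integrable_mult_left integrable_abs int)
  qed (use pw in auto)
  finally show "norm ((CLINT \<omega>|M. ?g n (u + h) \<omega>) - (CLINT \<omega>|M. ?g n u \<omega>)
       - h *\<^sub>R (CLINT \<omega>|M. ?g (Suc n) u \<omega>)) \<le> (\<integral>\<omega>. \<bar>Z \<omega> ^ (n + 2)\<bar> \<partial>M) * h\<^sup>2"
    by simp
qed

lemma taylor_family_char_fps:
  fixes Z :: "'a \<Rightarrow> real"
  assumes "Z \<in> borel_measurable M" "\<And>n. integrable M (\<lambda>\<omega>. Z \<omega> ^ n)"
  shows "taylor_family (char_fps M Z)"
  unfolding taylor_family_def
proof (intro allI)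
  fix n u
  have "((\<lambda>u. (CLINT \<omega>|M. (\<i> * Z \<omega>) ^ n * iexp (u * Z \<omega>)) / fact n) has_vector_derivative
          (CLINT \<omega>|M. (\<i> * Z \<omega>) ^ Suc n * iexp (u * Z \<omega>)) / fact n) (at u)"
    unfolding divide_inverse
    by (intro has_vector_derivative_mult_left has_vector_derivative_moment_iexp assms)
  then show "((\<lambda>u. fps_nth (char_fps M Z u) n) has_vector_derivative
      fps_nth (fps_deriv (char_fps M Z u)) n) (at u)"
    by (simp add: char_fps_def field_simps del: power_Suc of_nat_Suc)
qed

lemma char_fps_0: "fps_nth (char_fps M Z u) 0 = (CLINT \<omega>|M. iexp (u * Z \<omega>))"
  by (simp add: char_fps_def)

lemma char_fps_at_0:
  fixes Z :: "'a \<Rightarrow> real"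
  shows "fps_nth (char_fps M Z 0) n = \<i> ^ n * (\<integral>\<omega>. Z \<omega> ^ n \<partial>M) / fact n"
proof -
  have "(CLINT \<omega>|M. (\<i> * Z \<omega>) ^ n) = (CLINT \<omega>|M. \<i> ^ n * of_real (Z \<omega> ^ n))"
    by (simp add: power_mult_distrib)
  also have "\<dots> = \<i> ^ n * of_real (\<integral>\<omega>. Z \<omega> ^ n \<partial>M)"
    unfolding integral_mult_right_zero integral_complex_of_real ..
  finally show ?thesis by (simp add: char_fps_def)
qed

end

text \<open>Near u the continuous logarithm is a shifted principal branch,
  \<open>\<psi> v = \<psi> u + Ln (\<phi> v / \<phi> u)\<close>, since by continuity the imaginary
  part of \<open>\<psi> v - \<psi> u\<close> stays below 1 < pi. Differentiability of \<psi> is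
  thereby deduced from that of \<phi>.\<close>

lemma log_derivative:
  fixes \<psi> \<phi> :: "real \<Rightarrow> complex"
  assumes cont: "continuous_on UNIV \<psi>" and e: "\<And>u. \<phi> u = exp (\<psi> u)"
    and d: "(\<phi> has_vector_derivative D) (at u)"
  shows "(\<psi> has_vector_derivative D / \<phi> u) (at u)"
proof -
  have nz: "\<phi> u \<noteq> 0" by (simp add: e)
  have 1: "((\<lambda>v. \<phi> v / \<phi> u) has_vector_derivative D / \<phi> u) (at u)"
    using d unfolding divide_inverse by (rule has_vector_derivative_mult_left)
  have "(Ln has_field_derivative inverse 1) (at (\<phi> u / \<phi> u))"
    using has_field_derivative_Ln[of 1] nz by simp
  from field_vector_diff_chain_at[OF 1 this]
  have 2: "((\<lambda>v. \<psi> u + Ln (\<phi> v / \<phi> u)) has_vector_derivative D / \<phi> u) (at u)"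
    by (auto simp: o_def intro!: derivative_eq_intros)
  have "\<forall>\<^sub>F v in nhds u. dist (\<psi> v) (\<psi> u) < 1"
    using cont unfolding continuous_on_eq_continuous_at[OF open_UNIV] isCont_def
    by (metis UNIV_I tendsto_at_iff_tendsto_nhds tendstoD zero_less_one)
  then have "\<forall>\<^sub>F v in nhds u. \<psi> u + Ln (\<phi> v / \<phi> u) = \<psi> v"
  proof eventually_elim
    case (elim v)
    have "\<bar>Im (\<psi> v - \<psi> u)\<bar> < 1"
      using elim abs_Im_le_cmod[of "\<psi> v - \<psi> u"] by (simp add: dist_norm)
    then have "Ln (exp (\<psi> v - \<psi> u)) = \<psi> v - \<psi> u"
      using pi_gt3 by (intro Ln_exp) auto
    then show ?case by (simp add: e exp_diff)
  qed
  then have ev: "\<forall>\<^sub>F v in nhds u. v \<in> UNIV \<longrightarrow> \<psi> u + Ln (\<phi> v / \<phi> u) = \<psi> v"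
    by simp
  moreover have "\<psi> u + Ln (\<phi> u / \<phi> u) = \<psi> u"
    using nz by simp
  ultimately show ?thesis
    using 2 has_vector_derivative_cong_ev[OF ev] by blast
qed

text \<open>Here \<open>\<phi>'\<close> is the c-th power of \<phi>, not a derivative. Clearing
  denominators in D'/\<phi>' = c D/\<phi> leaves products, which have a counterpart among formal
  power series.\<close>

lemma exp_mult_log_derivative:
  fixes \<psi> \<phi> :: "real \<Rightarrow> complex"
  assumes cont: "continuous_on UNIV \<psi>" and e: "\<And>u. \<phi> u = exp (\<psi> u)"
    and e': "\<And>u. \<phi>' u = exp (c * \<psi> u)"
    and d: "(\<phi> has_vector_derivative D) (at u)" and d': "(\<phi>' has_vector_derivative D') (at u)"
  shows "D' * \<phi> u = c * D * \<phi>' u"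
proof -
  have 1: "((\<lambda>u. c * \<psi> u) has_vector_derivative c * (D / \<phi> u)) (at u)"
    by (intro has_vector_derivative_mult_right log_derivative[OF cont e d])
  have "((\<lambda>u. exp (c * \<psi> u)) has_vector_derivative (c * (D / \<phi> u)) * exp (c * \<psi> u)) (at u)"
    using field_vector_diff_chain_at[OF 1 DERIV_exp] by (simp add: o_def)
  moreover have "\<phi>' = (\<lambda>u. exp (c * \<psi> u))"
    using e' by auto
  ultimately have "(\<phi>' has_vector_derivative c * (D / \<phi> u) * \<phi>' u) (at u)"
    by simp
  from vector_derivative_unique_at[OF d' this] have "D' = c * (D / \<phi> u) * \<phi>' u" .
  moreover have "\<phi> u \<noteq> 0" by (simp add: e)
  ultimately show ?thesis by simp
qed

text \<open>The coefficients of the logarithmic derivative of the moment series are, up to powers of the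
  imaginary unit and factorials, the cumulants.\<close>

definition cumulant_fps :: "'a measure \<Rightarrow> ('a \<Rightarrow> real) \<Rightarrow> complex fps" where
  "cumulant_fps M X = fps_deriv (char_fps M X 0) * inverse (char_fps M X 0)"

context prob_space
begin

text \<open>The identity of logarithmic derivatives holds at every u, so
  \<open>taylor_family_eqI\<close> lifts it to the whole series; at 0 the series of X has constant
  term 1 and can be inverted. The result is the formal differential equation S' = c K S with the
  cumulant series K.\<close>

lemma fps_deriv_char_fps_power:
  fixes X Z :: "'a \<Rightarrow> real"
  assumes X: "X \<in> borel_measurable M" "\<And>n. integrable M (\<lambda>\<omega>. X \<omega> ^ n)"
    and Z: "Z \<in> borel_measurable M" "\<And>n. integrable M (\<lambda>\<omega>. Z \<omega> ^ n)"
    and \<psi>: "continuous_on UNIV \<psi>" "\<And>u. (CLINT \<omega>|M. iexp (u * X \<omega>)) = exp (\<psi> u)"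
      "\<And>u. (CLINT \<omega>|M. iexp (u * Z \<omega>)) = exp (c * \<psi> u)"
  shows "fps_deriv (char_fps M Z 0) = fps_const c * cumulant_fps M X * char_fps M Z 0"
proof -
  note tX = taylor_family_char_fps[OF X] and tZ = taylor_family_char_fps[OF Z]
  have "fps_deriv (char_fps M Z 0) * char_fps M X 0 =
        fps_const c * (fps_deriv (char_fps M X 0) * char_fps M Z 0)"
  proof (rule taylor_family_eqI[where S = "\<lambda>u. fps_deriv (char_fps M Z u) * char_fps M X u"])
    fix u
    have dX: "((\<lambda>u. fps_nth (char_fps M X u) 0) has_vector_derivative
        fps_nth (fps_deriv (char_fps M X u)) 0) (at u)"
      using tX unfolding taylor_family_def by blast
    have dZ: "((\<lambda>u. fps_nth (char_fps M Z u) 0) has_vector_derivative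
        fps_nth (fps_deriv (char_fps M Z u)) 0) (at u)"
      using tZ unfolding taylor_family_def by blast
    have "fps_nth (fps_deriv (char_fps M Z u)) 0 * fps_nth (char_fps M X u) 0 =
       c * fps_nth (fps_deriv (char_fps M X u)) 0 * fps_nth (char_fps M Z u) 0"
      by (rule exp_mult_log_derivative[OF \<psi>(1) _ _ dX dZ]) (rule trans[OF char_fps_0] \<psi>(2,3))+
    then show "fps_nth (fps_deriv (char_fps M Z u) * char_fps M X u) 0 =
       fps_nth (fps_const c * (fps_deriv (char_fps M X u) * char_fps M Z u)) 0"
      by simp
  qed (intro taylor_family_mult taylor_family_deriv taylor_family_const_mult tX tZ)+
  moreover have "char_fps M X 0 * inverse (char_fps M X 0) = 1"
    by (intro inverse_mult_eq_1') (simp add: char_fps_at_0 prob_space)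
  moreover have "fps_deriv (char_fps M Z 0) = fps_deriv (char_fps M Z 0) * char_fps M X 0 * inverse (char_fps M X 0)"
    unfolding mult.assoc calculation(2) by simp
  ultimately show ?thesis
    by (simp add: cumulant_fps_def mult_ac)
qed

lemma cumulant_fps_0:
  fixes X :: "'a \<Rightarrow> real"
  assumes "(\<integral>\<omega>. X \<omega> \<partial>M) = 0"
  shows "fps_nth (cumulant_fps M X) 0 = 0"
  using assms by (simp add: cumulant_fps_def char_fps_at_0 fps_mult_nth)

end

section \<open>The moment-cumulant recursion and its estimates in the power c\<close>

lemma fps_log_deriv_nth:
  fixes K :: "complex fps"
  assumes "fps_deriv S = fps_const c * K * S"
  shows "of_nat (Suc m) * fps_nth S (Suc m) = c * (\<Sum>i=0..m. fps_nth K i * fps_nth S (m - i))"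
proof -
  have "of_nat (Suc m) * fps_nth S (Suc m) = fps_nth (fps_deriv S) m"
    by simp
  also have "\<dots> = c * fps_nth (K * S) m"
    unfolding assms mult.assoc fps_mult_left_const_nth ..
  finally show ?thesis
    by (simp only: fps_mult_nth)
qed

text \<open>Since K has no constant term, the recursion for coefficient m+1 multiplies c only with
  coefficients of index at most m-1: each factor c costs two steps, whence the exponent n/2. The
  constant depends on K and n, not on c or S.\<close>

lemma coeff_bound_ge_1:
  fixes K :: "complex fps"
  assumes K0: "fps_nth K 0 = 0"
  shows "\<exists>A. \<forall>c S. 1 \<le> c \<longrightarrow> fps_nth S 0 = 1 \<longrightarrow> fps_deriv S = fps_const (of_real c) * K * S \<longrightarrow>
           norm (fps_nth S n) \<le> A * c powr (n / 2)"
proof (induction n rule: less_induct)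
  case (less n)
  then obtain A where A: "\<And>m c S. m < n \<Longrightarrow> 1 \<le> c \<Longrightarrow> fps_nth S 0 = 1 \<Longrightarrow>
      fps_deriv S = fps_const (of_real c) * K * S \<Longrightarrow> norm (fps_nth S m) \<le> A m * c powr (m / 2)"
    by metis
  show ?case
  proof (cases n)
    case 0
    then show ?thesis by (intro exI[of _ 1]) auto
  next
    case (Suc m)
    show ?thesis
    proof (intro exI allI impI)
      fix c :: real and S :: "complex fps"
      assume c: "1 \<le> c" and S: "fps_nth S 0 = 1" "fps_deriv S = fps_const (of_real c) * K * S"
      note eq = fps_log_deriv_nth[OF S(2), of m]
      have t: "norm (fps_nth K i * fps_nth S (m - i)) \<le> norm (fps_nth K i) * \<bar>A (m - i)\<bar> * c powr ((real m - 1) / 2)"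
        if "i \<le> m" for i
      proof (cases "i = 0")
        case False
        have "norm (fps_nth S (m - i)) \<le> A (m - i) * c powr (real (m - i) / 2)"
          using A[OF _ c S] Suc by auto
        also have "\<dots> \<le> \<bar>A (m - i)\<bar> * c powr ((real m - 1) / 2)"
          using False that c by (intro mult_mono powr_mono) (auto simp: of_nat_diff)
        finally show ?thesis
          by (simp add: norm_mult mult.assoc mult_left_mono)
      qed (use K0 in simp)
      have "norm (fps_nth S n) \<le> norm (of_nat (Suc m) * fps_nth S (Suc m))"
        using Suc by (simp add: norm_mult mult_le_cancel_right1 del: of_nat_Suc)
      also have "\<dots> \<le> c * (\<Sum>i=0..m. norm (fps_nth K i) * \<bar>A (m - i)\<bar> * c powr ((real m - 1) / 2))"
        unfolding eq norm_mult using c t by (intro mult_mono order_trans[OF norm_sum] sum_mono) auto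
      also have "\<dots> = (\<Sum>i=0..m. norm (fps_nth K i) * \<bar>A (m - i)\<bar>) * (c powr 1 * c powr ((real m - 1) / 2))"
        using c by (simp add: sum_distrib_right sum_distrib_left mult_ac)
      also have "c powr 1 * c powr ((real m - 1) / 2) = c powr (n / 2)"
        unfolding powr_add[symmetric] Suc by (simp add: field_simps)
      finally show "norm (fps_nth S n) \<le> (\<Sum>i=0..m. norm (fps_nth K i) * \<bar>A (m - i)\<bar>) * c powr (n / 2)" .
    qed
  qed
qed

text \<open>For c at most 1 the lower coefficients are bounded by constants, and the factor c in
  front of the recursion is what remains. Coefficient 0 equals 1 and is the exception. Nonnegativity
  of A lets A c be bounded by A in the induction.\<close>

lemma coeff_bound_le_1:
  fixes K :: "complex fps"
  shows "\<exists>A\<ge>0. \<forall>c S. 0 \<le> c \<longrightarrow> c \<le> 1 \<longrightarrow> fps_nth S 0 = 1 \<longrightarrow> fps_deriv S = fps_const (of_real c) * K * S \<longrightarrow>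
           norm (fps_nth S n) \<le> (if n = 0 then 1 else A * c)"
proof (induction n rule: less_induct)
  case (less n)
  then obtain A where A: "\<And>m c S. m < n \<Longrightarrow> 0 \<le> c \<Longrightarrow> c \<le> 1 \<Longrightarrow> fps_nth S 0 = 1 \<Longrightarrow>
      fps_deriv S = fps_const (of_real c) * K * S \<Longrightarrow> norm (fps_nth S m) \<le> (if m = 0 then 1 else A m * c)"
    and A0: "\<And>m. m < n \<Longrightarrow> 0 \<le> A m"
    by metis
  show ?case
  proof (cases n)
    case 0
    then show ?thesis by (intro exI[of _ 1]) auto
  next
    case (Suc m)
    show ?thesis
    proof (intro exI allI impI conjI)
      fix c :: real and S :: "complex fps"
      assume c: "0 \<le> c" "c \<le> 1" and S: "fps_nth S 0 = 1" "fps_deriv S = fps_const (of_real c) * K * S"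
      note eq = fps_log_deriv_nth[OF S(2), of m]
      have t: "norm (fps_nth K i * fps_nth S (m - i)) \<le> norm (fps_nth K i) * (1 + \<bar>A (m - i)\<bar>)" for i
      proof -
        have "m - i < n" using Suc by simp
        have "norm (fps_nth S (m - i)) \<le> (if m - i = 0 then 1 else A (m - i) * c)"
          by (rule A) (use c S Suc in auto)
        also have "\<dots> \<le> 1 + \<bar>A (m - i)\<bar>"
          using A0[OF \<open>m - i < n\<close>] c mult_left_le[of c "A (m - i)"] by auto
        finally show ?thesis
          by (simp add: norm_mult mult_left_mono)
      qed
      have "norm (fps_nth S n) \<le> norm (of_nat (Suc m) * fps_nth S (Suc m))"
        using Suc by (simp add: norm_mult mult_le_cancel_right1 del: of_nat_Suc)
      also have "\<dots> \<le> c * (\<Sum>i=0..m. norm (fps_nth K i) * (1 + \<bar>A (m - i)\<bar>))"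
        unfolding eq norm_mult using c t by (intro mult_mono order_trans[OF norm_sum] sum_mono) auto
      finally show "norm (fps_nth S n) \<le> (if n = 0 then 1 else (\<Sum>i=0..m. norm (fps_nth K i) * (1 + \<bar>A (m - i)\<bar>)) * c)"
        using Suc by (simp add: mult.commute)
    qed (auto intro!: sum_nonneg)
  qed
qed

text \<open>The scaling relation at one time, with both variables on the same space: the law of Z is
  the c-th convolution power of that of X. The moments of Z are included because the recursion
  starts from the derivatives of its characteristic function.\<close>

definition char_power :: "'a measure \<Rightarrow> ('a \<Rightarrow> real) \<Rightarrow> real \<Rightarrow> ('a \<Rightarrow> real) \<Rightarrow> bool" where
  "char_power M X c Z \<longleftrightarrow> Z \<in> borel_measurable M \<and> (\<forall>n. integrable M (\<lambda>\<omega>. Z \<omega> ^ n)) \<and>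
     (\<exists>\<psi>. continuous_on UNIV \<psi> \<and> (\<forall>u. (CLINT \<omega>|M. iexp (u * X \<omega>)) = exp (\<psi> u)) \<and>
           (\<forall>u. (CLINT \<omega>|M. iexp (u * Z \<omega>)) = exp (of_real c * \<psi> u)))"

locale centered_moments = prob_space +
  fixes X :: "'a \<Rightarrow> real"
  assumes measurable_X [measurable]: "X \<in> borel_measurable M"
    and moments_X: "integrable M (\<lambda>\<omega>. X \<omega> ^ n)"
    and mean_X: "(\<integral>\<omega>. X \<omega> \<partial>M) = 0"
begin

lemma char_fps_char_power:
  assumes "char_power M X c Z"
  shows "fps_nth (char_fps M Z 0) 0 = 1"
    and "fps_deriv (char_fps M Z 0) = fps_const (of_real c) * cumulant_fps M X * char_fps M Z 0"
    and "\<bar>\<integral>\<omega>. Z \<omega> ^ n \<partial>M\<bar> = fact n * norm (fps_nth (char_fps M Z 0) n)"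
proof -
  from assms obtain \<psi> where Z: "Z \<in> borel_measurable M" "\<And>n. integrable M (\<lambda>\<omega>. Z \<omega> ^ n)" and
    \<psi>: "continuous_on UNIV \<psi>" "\<And>u. (CLINT \<omega>|M. iexp (u * X \<omega>)) = exp (\<psi> u)"
      "\<And>u. (CLINT \<omega>|M. iexp (u * Z \<omega>)) = exp (of_real c * \<psi> u)"
    unfolding char_power_def by blast
  show "fps_deriv (char_fps M Z 0) = fps_const (of_real c) * cumulant_fps M X * char_fps M Z 0"
    by (rule fps_deriv_char_fps_power[OF measurable_X moments_X Z \<psi>])
qed (simp_all add: char_fps_at_0 prob_space norm_mult norm_divide norm_power del: of_real_power)

lemma moment_bound_ge_1:
  "\<exists>A. \<forall>c Z. 1 \<le> c \<longrightarrow> char_power M X c Z \<longrightarrow> \<bar>\<integral>\<omega>. Z \<omega> ^ n \<partial>M\<bar> \<le> A * c powr (n / 2)"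
proof -
  obtain A where "\<And>c S. 1 \<le> c \<Longrightarrow> fps_nth S 0 = 1 \<Longrightarrow>
      fps_deriv S = fps_const (of_real c) * cumulant_fps M X * S \<Longrightarrow> norm (fps_nth S n) \<le> A * c powr (n / 2)"
    using coeff_bound_ge_1[OF cumulant_fps_0[OF mean_X], of n] by blast
  then have "1 \<le> c \<Longrightarrow> char_power M X c Z \<Longrightarrow> \<bar>\<integral>\<omega>. Z \<omega> ^ n \<partial>M\<bar> \<le> (fact n * A) * c powr (n / 2)" for c Z
    using char_fps_char_power[of c Z] by (simp add: mult.assoc)
  then show ?thesis by blast
qed

lemma moment_bound_le_1:
  assumes "0 < n"
  shows "\<exists>A. \<forall>c Z. 0 \<le> c \<longrightarrow> c \<le> 1 \<longrightarrow> char_power M X c Z \<longrightarrow> \<bar>\<integral>\<omega>. Z \<omega> ^ n \<partial>M\<bar> \<le> A * c"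
proof -
  obtain A where "\<And>c S. 0 \<le> c \<Longrightarrow> c \<le> 1 \<Longrightarrow> fps_nth S 0 = 1 \<Longrightarrow>
      fps_deriv S = fps_const (of_real c) * cumulant_fps M X * S \<Longrightarrow> norm (fps_nth S n) \<le> A * c"
    using coeff_bound_le_1[of "cumulant_fps M X" n] assms unfolding neq0_conv[symmetric] if_not_P by auto
  then have "0 \<le> c \<Longrightarrow> c \<le> 1 \<Longrightarrow> char_power M X c Z \<Longrightarrow> \<bar>\<integral>\<omega>. Z \<omega> ^ n \<partial>M\<bar> \<le> (fact n * A) * c" for c Z
    using char_fps_char_power[of c Z] by (simp add: mult.assoc)
  then show ?thesis by blast
qed

text \<open>In order two the recursion is exact: twice coefficient 2 is c times cumulant coefficient
  1, and the case c = 1, that is X itself, identifies the latter.\<close>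

lemma second_moment_char_power:
  assumes "char_power M X c Z"
  shows "(\<integral>\<omega>. (Z \<omega>)\<^sup>2 \<partial>M) = c * (\<integral>\<omega>. (X \<omega>)\<^sup>2 \<partial>M)"
proof -
  note Z = char_fps_char_power(1,2)[OF assms]
  have nth2: "2 * fps_nth S 2 = a * fps_nth (cumulant_fps M X) 1"
    if "fps_nth S 0 = 1" "fps_deriv S = fps_const a * cumulant_fps M X * S" for S a
    using fps_log_deriv_nth[OF that(2), of 1] that(1) cumulant_fps_0[OF mean_X]
    by (simp add: numeral_2_eq_2)
  have "char_power M X 1 X"
    using assms measurable_X moments_X unfolding char_power_def of_real_1 mult_1_left by blast
  from nth2[OF char_fps_char_power(1,2)[OF this]] nth2[OF Z]
  have "2 * fps_nth (char_fps M Z 0) 2 = c * (2 * fps_nth (char_fps M X 0) 2)"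
    by simp
  then have "complex_of_real (\<integral>\<omega>. (Z \<omega>)\<^sup>2 \<partial>M) = of_real (c * (\<integral>\<omega>. (X \<omega>)\<^sup>2 \<partial>M))"
    unfolding char_fps_at_0 by simp
  then show ?thesis
    unfolding of_real_eq_iff .
qed

end

subsection \<open>The Kolmogorov-Chentsov theorem\<close>

definition dyadic_floor :: "nat \<Rightarrow> real \<Rightarrow> real" where
  "dyadic_floor n t = real (nat \<lfloor>2 ^ n * t\<rfloor>) / 2 ^ n"

lemma dyadic_floor_nonneg: "0 \<le> dyadic_floor n t"
  by (simp add: dyadic_floor_def)

lemma dyadic_floor_bounds:
  assumes "0 \<le> t"
  shows "dyadic_floor n t \<le> t" "t < dyadic_floor n t + (1 / 2) ^ n"
proof -
  have "real (nat \<lfloor>2 ^ n * t\<rfloor>) = of_int \<lfloor>2 ^ n * t\<rfloor>"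
    using assms by simp
  then have "real (nat \<lfloor>2 ^ n * t\<rfloor>) \<le> 2 ^ n * t" "2 ^ n * t < real (nat \<lfloor>2 ^ n * t\<rfloor>) + 1"
    by linarith+
  then show "dyadic_floor n t \<le> t" "t < dyadic_floor n t + (1 / 2) ^ n"
    by (simp_all add: dyadic_floor_def field_simps)
qed

lemma dyadic_floor_index:
  assumes "0 \<le> t" "t < real K"
  shows "nat \<lfloor>2 ^ n * t\<rfloor> < K * 2 ^ n"
proof -
  have "of_int \<lfloor>2 ^ n * t\<rfloor> \<le> 2 ^ n * t"
    by (rule of_int_floor_le)
  also have "\<dots> < 2 ^ n * real K"
    using assms by simp
  also have "\<dots> = of_int (int (K * 2 ^ n))"
    by simp
  finally have "\<lfloor>2 ^ n * t\<rfloor> < int (K * 2 ^ n)"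
    unfolding of_int_less_iff .
  then show ?thesis
    using assms by (simp add: nat_less_iff)
qed

text \<open>The limit along dyadic approximations from below inherits the modulus of continuity seen on
  the dyadic grids: consecutive approximations of one point, and equal-level approximations of two
  points at distance at most \<open>1 / 2 ^ n\<close>, are equal or neighbours on a grid.\<close>

locale dyadic_increments =
  fixes f :: "real \<Rightarrow> real" and K N :: nat and q :: real
  assumes q: "0 < q" "q < 1"
    and step: "\<And>n k. N \<le> n \<Longrightarrow> k < K * 2 ^ n \<Longrightarrow> \<bar>f (real (Suc k) / 2 ^ n) - f (real k / 2 ^ n)\<bar> \<le> q ^ n"
begin

lemma level_step:
  assumes t: "0 \<le> t" "t < real K" and n: "N \<le> n"
  shows "\<bar>f (dyadic_floor (Suc n) t) - f (dyadic_floor n t)\<bar> \<le> q ^ Suc n"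
proof -
  define m where "m = nat \<lfloor>2 ^ n * t\<rfloor>"
  have m: "real m \<le> 2 ^ n * t" "2 ^ n * t < real m + 1"
    using t by (simp_all add: m_def)
  have eq: "dyadic_floor n t = real (2 * m) / 2 ^ Suc n"
    by (simp add: dyadic_floor_def m_def)
  \<comment> \<open>Halving the mesh either keeps the approximation or moves it to the right
    neighbour on the finer grid.\<close>
  have "\<lfloor>2 ^ Suc n * t\<rfloor> = 2 * int m \<or> \<lfloor>2 ^ Suc n * t\<rfloor> = 2 * int m + 1"
    using m by (simp add: floor_eq_iff) linarith
  then have "nat \<lfloor>2 ^ Suc n * t\<rfloor> = 2 * m \<or> nat \<lfloor>2 ^ Suc n * t\<rfloor> = Suc (2 * m)"
    by auto
  then consider "dyadic_floor (Suc n) t = real (2 * m) / 2 ^ Suc n"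
    | "dyadic_floor (Suc n) t = real (Suc (2 * m)) / 2 ^ Suc n"
    unfolding dyadic_floor_def by metis
  then show ?thesis
  proof cases
    case 1
    then show ?thesis using eq q by simp
  next
    case 2
    have "2 * m < K * 2 ^ Suc n"
      using dyadic_floor_index[OF t, of n] by (simp add: m_def)
    then show ?thesis
      unfolding 2 eq using n by (intro step) auto
  qed
qed

lemma level_steps:
  assumes t: "0 \<le> t" "t < real K" and n: "N \<le> n"
  shows "\<bar>f (dyadic_floor (n + d) t) - f (dyadic_floor n t)\<bar> \<le> (q ^ n - q ^ (n + d)) / (1 - q)"
proof (induction d)
  case (Suc d)
  have "\<bar>f (dyadic_floor (n + Suc d) t) - f (dyadic_floor n t)\<bar> \<le>
      q ^ Suc (n + d) + (q ^ n - q ^ (n + d)) / (1 - q)"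
    using level_step[OF t, of "n + d"] n Suc by simp
  \<comment> \<open>Giving away one factor q makes the sum telescope to (q^n - q^(n+d+1)) /
    (1-q).\<close>
  also have "q ^ Suc (n + d) \<le> q ^ (n + d)"
    using q by (intro power_decreasing) auto
  also have "q ^ (n + d) + (q ^ n - q ^ (n + d)) / (1 - q) = (q ^ n - q ^ (n + Suc d)) / (1 - q)"
    using q by (simp add: field_simps)
  finally show ?case by simp
qed simp

lemma level_steps':
  assumes t: "0 \<le> t" "t < real K" and n: "N \<le> n" "n \<le> m"
  shows "\<bar>f (dyadic_floor m t) - f (dyadic_floor n t)\<bar> \<le> q ^ n / (1 - q)"
proof -
  obtain d where d: "m = n + d" using n le_iff_add by blast
  show ?thesis
    unfolding d using q by (intro order_trans[OF level_steps[OF t n(1)]] divide_right_mono) auto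
qed

lemma convergent_levels:
  assumes t: "0 \<le> t" "t < real K"
  shows "convergent (\<lambda>n. f (dyadic_floor n t))"
  unfolding Cauchy_convergent_iff[symmetric]
proof (rule metric_CauchyI)
  fix e :: real assume "0 < e"
  have "(\<lambda>n. 2 * (q ^ n / (1 - q))) \<longlonglongrightarrow> 2 * (0 / (1 - q))"
    using q by (intro tendsto_intros LIMSEQ_realpow_zero) auto
  then have "\<forall>\<^sub>F n in sequentially. 2 * (q ^ n / (1 - q)) < e \<and> N \<le> n"
    using \<open>0 < e\<close> by (intro eventually_conj order_tendstoD(2) eventually_ge_at_top) auto
  then obtain n where n: "2 * (q ^ n / (1 - q)) < e" "N \<le> n"
    unfolding eventually_sequentially by blast
  show "\<exists>n. \<forall>i\<ge>n. \<forall>j\<ge>n. dist (f (dyadic_floor i t)) (f (dyadic_floor j t)) < e"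
  proof (intro exI allI impI)
    fix i j assume "n \<le> i" "n \<le> j"
    from level_steps'[OF t n(2) this(1)] level_steps'[OF t n(2) this(2)] n(1)
    show "dist (f (dyadic_floor i t)) (f (dyadic_floor j t)) < e"
      unfolding dist_real_def by linarith
  qed
qed

definition dyadic_limit :: "real \<Rightarrow> real" where
  "dyadic_limit t = lim (\<lambda>n. f (dyadic_floor n t))"

lemma dyadic_limit_level:
  assumes t: "0 \<le> t" "t < real K" and n: "N \<le> n"
  shows "\<bar>dyadic_limit t - f (dyadic_floor n t)\<bar> \<le> q ^ n / (1 - q)"
proof (rule tendsto_upperbound)
  have "(\<lambda>m. f (dyadic_floor m t)) \<longlonglongrightarrow> dyadic_limit t"
    unfolding dyadic_limit_def convergent_LIMSEQ_iff[symmetric] by (rule convergent_levels[OF t])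
  then show "(\<lambda>m. \<bar>f (dyadic_floor m t) - f (dyadic_floor n t)\<bar>) \<longlonglongrightarrow> \<bar>dyadic_limit t - f (dyadic_floor n t)\<bar>"
    by (intro tendsto_intros)
  show "\<forall>\<^sub>F m in sequentially. \<bar>f (dyadic_floor m t) - f (dyadic_floor n t)\<bar> \<le> q ^ n / (1 - q)"
    using eventually_ge_at_top[of n] by eventually_elim (rule level_steps'[OF t n])
qed auto

lemma same_level:
  assumes st: "0 \<le> s" "s \<le> t" "t < real K" and n: "N \<le> n" "t - s \<le> (1 / 2) ^ n"
  shows "\<bar>f (dyadic_floor n t) - f (dyadic_floor n s)\<bar> \<le> q ^ n"
proof -
  define m where "m = nat \<lfloor>2 ^ n * s\<rfloor>"
  define l where "l = nat \<lfloor>2 ^ n * t\<rfloor>"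
  have "2 ^ n * t - 2 ^ n * s \<le> 1" "2 ^ n * s \<le> 2 ^ n * t"
    using n st by (simp_all add: field_simps)
  then have "\<lfloor>2 ^ n * t\<rfloor> = \<lfloor>2 ^ n * s\<rfloor> \<or> \<lfloor>2 ^ n * t\<rfloor> = \<lfloor>2 ^ n * s\<rfloor> + 1"
    by linarith
  moreover have "0 \<le> \<lfloor>2 ^ n * s\<rfloor>"
    using st by simp
  ultimately have "l = m \<or> l = Suc m"
    unfolding m_def l_def by linarith
  then show ?thesis
  proof
    assume "l = m"
    then show ?thesis using q by (simp add: dyadic_floor_def l_def m_def)
  next
    assume "l = Suc m"
    moreover have "m < K * 2 ^ n"
      unfolding m_def using st by (intro dyadic_floor_index) auto
    ultimately show ?thesis
      using step[OF n(1), of m] by (simp add: dyadic_floor_def flip: l_def m_def)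
  qed
qed

text \<open>Takes care of points too far apart for the grid estimates: below K there are only
  finitely many grid points of level N, and the limit is within q^N / (1-q) of the value at one of
  them.\<close>

lemma dyadic_limit_bounded:
  "\<exists>B. \<forall>t. 0 \<le> t \<and> t < real K \<longrightarrow> \<bar>dyadic_limit t\<bar> \<le> B"
proof (intro exI allI impI)
  fix t assume t: "0 \<le> t \<and> t < real K"
  have "\<bar>f (dyadic_floor N t)\<bar> \<le> Max ((\<lambda>k. \<bar>f (real k / 2 ^ N)\<bar>) ` {..<K * 2 ^ N})"
    using dyadic_floor_index[of t K N] t unfolding dyadic_floor_def by (intro Max_ge) blast+
  then show "\<bar>dyadic_limit t\<bar> \<le> q ^ N / (1 - q) + Max ((\<lambda>k. \<bar>f (real k / 2 ^ N)\<bar>) ` {..<K * 2 ^ N})"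
    using dyadic_limit_level[of t N] t by linarith
qed

text \<open>With this q, q^n = (2^-n)^\<gamma>. Points further apart than 2^-N are handled by
  boundedness; for the others, n \<ge> N is chosen with 2^-(n+1) < t-s \<le> 2^-n.\<close>

lemma dyadic_limit_holder:
  assumes \<gamma>: "0 < \<gamma>" and q_def: "q = 2 powr - \<gamma>"
  shows "\<exists>C. \<forall>s t. 0 \<le> s \<and> s < real K \<and> 0 \<le> t \<and> t < real K \<longrightarrow>
           \<bar>dyadic_limit t - dyadic_limit s\<bar> \<le> C * \<bar>t - s\<bar> powr \<gamma>"
proof -
  obtain B where B: "\<And>t. 0 \<le> t \<Longrightarrow> t < real K \<Longrightarrow> \<bar>dyadic_limit t\<bar> \<le> B"
    using dyadic_limit_bounded by blast
  have qn: "q ^ n = ((1 / 2) ^ n) powr \<gamma>" for n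
  proof -
    have "(1 / 2) ^ n = (2 :: real) powr - real n"
      by (simp add: powr_minus powr_realpow field_simps)
    then show ?thesis
      by (simp add: q_def powr_power powr_powr mult.commute)
  qed
  \<comment> \<open>The first summand serves close points, the second distant ones.\<close>
  define C where "C = (2 / (1 - q) + 1) / q + 2 * \<bar>B\<bar> / q ^ N"
  have C: "0 \<le> (2 / (1 - q) + 1) / q" "0 \<le> 2 * \<bar>B\<bar> / q ^ N"
    using q by auto
  have main: "\<bar>dyadic_limit t - dyadic_limit s\<bar> \<le> C * \<bar>t - s\<bar> powr \<gamma>"
    if st: "0 \<le> s" "s < t" "t < real K" for s t
  proof (cases "t - s \<le> (1 / 2) ^ N")
    case False
    then have "((1 / 2) ^ N) powr \<gamma> \<le> (t - s) powr \<gamma>"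
      using \<gamma> by (intro powr_mono2) auto
    then have "q ^ N \<le> \<bar>t - s\<bar> powr \<gamma>"
      using st unfolding qn by simp
    then have "2 * \<bar>B\<bar> \<le> 2 * \<bar>B\<bar> / q ^ N * \<bar>t - s\<bar> powr \<gamma>"
      using q by (simp add: field_simps mult_left_mono)
    also have "\<dots> \<le> C * \<bar>t - s\<bar> powr \<gamma>"
      unfolding C_def using C by (intro mult_right_mono) auto
    finally show ?thesis
      using B[of t] B[of s] st by linarith
  next
    case True
    define m where "m = (LEAST m. (1 / 2) ^ m < t - s)"
    have ex: "\<exists>m. (1 / 2) ^ m < t - s"
      using st by (intro real_arch_pow_inv) auto
    have m: "(1 / 2) ^ m < t - s"
      unfolding m_def using ex by (rule LeastI_ex)
    have m': "\<not> (1 / 2) ^ k < t - s" if "k < m" for k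
      using that unfolding m_def by (rule not_less_Least)
    have "N < m"
    proof (rule ccontr)
      assume "\<not> N < m"
      then have "(1 / 2) ^ N \<le> ((1 / 2) ^ m :: real)"
        by (intro power_decreasing) auto
      then show False using m True by linarith
    qed
    then obtain n where n: "m = Suc n" "N \<le> n"
      by (cases m) auto
    have h: "t - s \<le> (1 / 2) ^ n"
      using m'[of n] n by simp
    \<comment> \<open>Two errors between the limit and the grid of level n, and one step on that
      grid.\<close>
    have "\<bar>dyadic_limit t - dyadic_limit s\<bar> \<le> q ^ n / (1 - q) + q ^ n / (1 - q) + q ^ n"
      using dyadic_limit_level[of t n] dyadic_limit_level[of s n] same_level[of s t n] st n h by auto
    \<comment> \<open>The distance is known to exceed 2^-(n+1), not 2^-n, which accounts for the
      division by q.\<close>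
    also have "\<dots> = (2 / (1 - q) + 1) / q * q ^ Suc n"
    proof -
      have "(2 / (1 - q) + 1) / q * q ^ Suc n = (2 / (1 - q) + 1) * q ^ n"
        using q by simp
      then show ?thesis by (simp add: distrib_right)
    qed
    also have "\<dots> \<le> (2 / (1 - q) + 1) / q * (t - s) powr \<gamma>"
      unfolding qn using m n \<gamma> C by (intro mult_left_mono powr_mono2) auto
    also have "\<dots> \<le> C * (t - s) powr \<gamma>"
      unfolding C_def using C by (intro mult_right_mono) auto
    finally show ?thesis
      using st by simp
  qed
  have "\<bar>dyadic_limit t - dyadic_limit s\<bar> \<le> C * \<bar>t - s\<bar> powr \<gamma>"
    if "0 \<le> s" "s < real K" "0 \<le> t" "t < real K" for s t
    using main[of s t] main[of t s] that
    by (cases s t rule: linorder_cases) (auto simp: abs_minus_commute)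
  then show ?thesis by blast
qed

end

lemma locally_holder_onD:
  assumes "locally_holder_on I \<gamma> f" "is_interval J" "bounded J" "J \<subseteq> I"
  obtains C where "\<And>s t. s \<in> J \<Longrightarrow> t \<in> J \<Longrightarrow> \<bar>f t - f s\<bar> \<le> C * \<bar>t - s\<bar> powr \<gamma>"
proof -
  from assms obtain C where
    C: "\<And>x. x \<in> {\<bar>f t - f s\<bar> / \<bar>t - s\<bar> powr \<gamma> | t s. t \<in> J \<and> s \<in> J \<and> t \<noteq> s} \<Longrightarrow> x \<le> C"
    unfolding locally_holder_on_def bdd_above_def by blast
  have "\<bar>f t - f s\<bar> \<le> C * \<bar>t - s\<bar> powr \<gamma>" if "s \<in> J" "t \<in> J" for s t
  proof (cases "s = t")
    case False
    then have "\<bar>f t - f s\<bar> / \<bar>t - s\<bar> powr \<gamma> \<le> C"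
      using that by (intro C) blast
    then show ?thesis
      using False by (simp add: divide_le_eq)
  qed simp
  then show ?thesis using that by blast
qed

text \<open>Every bounded interval in the half-line lies in some [0, K), so integer end points
  suffice.\<close>

lemma locally_holder_onI:
  assumes "\<And>K :: nat. \<exists>C. \<forall>s t. 0 \<le> s \<and> s < real K \<and> 0 \<le> t \<and> t < real K \<longrightarrow>
           \<bar>f t - f s\<bar> \<le> C * \<bar>t - s\<bar> powr \<gamma>"
  shows "locally_holder_on {0..} \<gamma> f"
  unfolding locally_holder_on_def
proof (intro allI impI)
  fix J :: "real set" assume J: "is_interval J \<and> bounded J \<and> J \<subseteq> {0..}"
  then obtain b where "\<forall>x\<in>J. \<bar>x\<bar> \<le> b"
    unfolding bounded_iff by auto
  moreover obtain K :: nat where "b < real K"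
    using reals_Archimedean2 by blast
  ultimately have JK: "J \<subseteq> {0..<real K}"
    using J by fastforce
  obtain C where C: "\<forall>s t. 0 \<le> s \<and> s < real K \<and> 0 \<le> t \<and> t < real K \<longrightarrow> \<bar>f t - f s\<bar> \<le> C * \<bar>t - s\<bar> powr \<gamma>"
    using assms by blast
  show "bdd_above {\<bar>f t - f s\<bar> / \<bar>t - s\<bar> powr \<gamma> | t s. t \<in> J \<and> s \<in> J \<and> t \<noteq> s}"
  proof (rule bdd_aboveI)
    fix x assume "x \<in> {\<bar>f t - f s\<bar> / \<bar>t - s\<bar> powr \<gamma> | t s. t \<in> J \<and> s \<in> J \<and> t \<noteq> s}"
    then obtain t s where x: "x = \<bar>f t - f s\<bar> / \<bar>t - s\<bar> powr \<gamma>" and ts: "t \<in> J" "s \<in> J" "t \<noteq> s"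
      by blast
    then have "\<bar>f t - f s\<bar> \<le> C * \<bar>t - s\<bar> powr \<gamma>"
      using C JK[THEN subsetD, of s] JK[THEN subsetD, of t] by simp
    then show "x \<le> C"
      using ts by (simp add: x divide_le_eq)
  qed
qed

lemma locally_holder_on_imp_continuous_on:
  assumes "locally_holder_on {0..} \<gamma> f" "0 < \<gamma>"
  shows "continuous_on {0..} f"
  unfolding continuous_on_def
proof
  fix x :: real assume x: "x \<in> {0..}"
  obtain C where C: "\<And>s t. s \<in> {0..x + 1} \<Longrightarrow> t \<in> {0..x + 1} \<Longrightarrow> \<bar>f t - f s\<bar> \<le> C * \<bar>t - s\<bar> powr \<gamma>"
    by (rule locally_holder_onD[OF assms(1), of "{0..x + 1}"]) auto
  have "((\<lambda>t. f t - f x) \<longlongrightarrow> 0) (at x within {0..})"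
  proof (rule Lim_null_comparison)
    have "\<forall>\<^sub>F t in at x within {0..}. t < x + 1"
      by (intro order_tendstoD(2)[where a = "x + 1" and f = "\<lambda>t. t"] tendsto_intros) auto
    then show "\<forall>\<^sub>F t in at x within {0..}. norm (f t - f x) \<le> C * \<bar>t - x\<bar> powr \<gamma>"
      unfolding eventually_at_filter by (rule eventually_mono) (use x C in auto)
    have "((\<lambda>t. C * \<bar>t - x\<bar> powr \<gamma>) \<longlongrightarrow> C * \<bar>x - x\<bar> powr \<gamma>) (at x within {0..})"
      using assms(2) by (intro tendsto_intros tendsto_powr') auto
    then show "((\<lambda>t. C * \<bar>t - x\<bar> powr \<gamma>) \<longlongrightarrow> 0) (at x within {0..})"
      by simp
  qed
  then show "(f \<longlongrightarrow> f x) (at x within {0..})"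
    by (simp add: LIM_zero_iff)
qed

text \<open>The moment condition of Kolmogorov and Chentsov. Increments are limited to length 1,
  because the moment bounds for the process are proved for times up to 1.\<close>

locale increment_moments = prob_space +
  fixes X :: "real \<Rightarrow> 'a \<Rightarrow> real" and p :: nat and C \<beta> \<gamma> :: real
  assumes measurable_X: "0 \<le> t \<Longrightarrow> X t \<in> borel_measurable M"
    and integrable_increment: "0 \<le> s \<Longrightarrow> s \<le> t \<Longrightarrow> t \<le> s + 1 \<Longrightarrow> integrable M (\<lambda>\<omega>. \<bar>X t \<omega> - X s \<omega>\<bar> ^ p)"
    and moment_increment: "0 \<le> s \<Longrightarrow> s \<le> t \<Longrightarrow> t \<le> s + 1 \<Longrightarrow>
          (\<integral>\<omega>. \<bar>X t \<omega> - X s \<omega>\<bar> ^ p \<partial>M) \<le> C * (t - s) powr (1 + \<beta>)"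
    and \<gamma>: "0 < \<gamma>" "\<gamma> * p < \<beta>" and p: "0 < p"
begin

definition q :: real where "q = 2 powr - \<gamma>"

lemma q: "0 < q" "q < 1"
  using \<gamma> powr_less_mono[of "- \<gamma>" 0 2] by (auto simp: q_def)

text \<open>Ratio of the geometric series behind Borel-Cantelli: 2^n increments, each with p-th
  moment of order 2^(-n(1+\<beta>)), against the threshold (q^n)^p.\<close>

definition r :: real where "r = 2 powr (\<gamma> * p - \<beta>)"

lemma r: "0 < r" "r < 1"
  using \<gamma> powr_less_mono[of "\<gamma> * p - \<beta>" 0 2] by (auto simp: r_def)

lemma C_nonneg: "0 \<le> C"
proof -
  have "0 \<le> (\<integral>\<omega>. \<bar>X 1 \<omega> - X 0 \<omega>\<bar> ^ p \<partial>M)"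
    by (intro integral_nonneg_AE) auto
  also have "\<dots> \<le> C"
    using moment_increment[of 0 1] by simp
  finally show ?thesis .
qed

text \<open>Markov's inequality for the p-th power. The factor 1 / 2^n is kept separate: it pays for
  the number of intervals on the grid.\<close>

lemma prob_increment:
  assumes "0 \<le> s" "s \<le> t" "t - s \<le> (1 / 2) ^ n"
  shows "prob {\<omega>\<in>space M. q ^ n < \<bar>X t \<omega> - X s \<omega>\<bar>} \<le> C * r ^ n / 2 ^ n"
proof -
  have meas [measurable]: "X t \<in> borel_measurable M" "X s \<in> borel_measurable M"
    using assms measurable_X by auto
  have "(1 / 2) ^ n \<le> (1 :: real)"
    by (simp add: power_le_one)
  then have st: "t \<le> s + 1"
    using assms by simp
  have "prob {\<omega>\<in>space M. q ^ n < \<bar>X t \<omega> - X s \<omega>\<bar>} \<le> prob {\<omega>\<in>space M. (q ^ n) ^ p \<le> \<bar>X t \<omega> - X s \<omega>\<bar> ^ p}"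
    using q by (intro finite_measure_mono subsetI) (auto intro!: power_mono)
  also have "\<dots> \<le> (\<integral>\<omega>. \<bar>X t \<omega> - X s \<omega>\<bar> ^ p \<partial>M) / (q ^ n) ^ p"
    using q integrable_increment[OF assms(1,2) st]
    by (intro integral_Markov_inequality_measure[where A = "space M"]) auto
  also have "\<dots> \<le> C * ((1 / 2) ^ n) powr (1 + \<beta>) / (q ^ n) ^ p"
  proof (intro divide_right_mono order_trans[OF moment_increment[OF assms(1,2) st]] mult_left_mono powr_mono2)
    have "0 \<le> \<gamma> * p" using \<gamma> by simp
    then show "0 \<le> 1 + \<beta>" using \<gamma> by linarith
  qed (use assms C_nonneg q in auto)
  also have "\<dots> = C * r ^ n / 2 ^ n"
  proof -
    have half: "(1 / 2) ^ n = (2 :: real) powr - real n"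
      by (simp add: powr_minus powr_realpow field_simps)
    have "((1 / 2) ^ n) powr (1 + \<beta>) / (q ^ n) ^ p = 2 powr (- real n * (1 + \<beta>) - (- \<gamma> * n * p))"
      unfolding half q_def powr_powr powr_power powr_diff by (simp add: powr_power mult_ac)
    also have "\<dots> = 2 powr ((\<gamma> * p - \<beta>) * n - n)"
      by (simp add: algebra_simps)
    also have "\<dots> = r ^ n / 2 ^ n"
      unfolding powr_diff by (simp add: r_def powr_power powr_realpow mult.commute)
    finally show ?thesis
      unfolding times_divide_eq_right[symmetric] mult.assoc by (rule arg_cong)
  qed
  finally show ?thesis .
qed

lemma AE_dyadic_increments:
  "AE \<omega> in M. \<forall>\<^sub>F n in sequentially. \<forall>k < K * 2 ^ n. \<bar>X (real (Suc k) / 2 ^ n) \<omega> - X (real k / 2 ^ n) \<omega>\<bar> \<le> q ^ n"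
proof -
  define A where "A n k = {\<omega>\<in>space M. q ^ n < \<bar>X (real (Suc k) / 2 ^ n) \<omega> - X (real k / 2 ^ n) \<omega>\<bar>}" for n k
  have A_meas [measurable]: "A n k \<in> sets M" for n k
  proof -
    have [measurable]: "X (real (Suc k) / 2 ^ n) \<in> borel_measurable M" "X (real k / 2 ^ n) \<in> borel_measurable M"
      by (auto intro!: measurable_X)
    show ?thesis unfolding A_def by measurable
  qed
  have "AE \<omega> in M. \<forall>\<^sub>F n in sequentially. \<omega> \<in> space M - (\<Union>k<K * 2 ^ n. A n k)"
  proof (rule borel_cantelli_AE1)
    show "summable (\<lambda>n. prob (\<Union>k<K * 2 ^ n. A n k))"
    proof (rule summable_comparison_test)
      show "\<exists>N. \<forall>n\<ge>N. norm (prob (\<Union>k<K * 2 ^ n. A n k)) \<le> real K * C * r ^ n"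
      proof (intro exI allI impI)
        fix n
        have "prob (\<Union>k<K * 2 ^ n. A n k) \<le> (\<Sum>k<K * 2 ^ n. prob (A n k))"
          by (intro finite_measure_subadditive_finite) auto
        also have "\<dots> \<le> (\<Sum>k<K * 2 ^ n. C * r ^ n / 2 ^ n)"
          unfolding A_def
          by (intro sum_mono prob_increment) (auto simp: field_simps)
        finally show "norm (prob (\<Union>k<K * 2 ^ n. A n k)) \<le> real K * C * r ^ n"
          by simp
      qed
      show "summable (\<lambda>n. real K * C * r ^ n)"
        using r by (intro summable_mult summable_geometric) auto
    qed
  qed (auto simp: less_top[symmetric])
  then show ?thesis
    by eventually_elim (auto elim!: eventually_mono simp: A_def not_less)
qed

text \<open>One increment per level is considered here, so the bound of
  \<open>prob_increment\<close> is summable even without its factor 1 / 2^n. This identifies the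
  dyadic limit with X t, which makes it a modification.\<close>

lemma AE_dyadic_floor_tendsto:
  assumes t: "0 \<le> t"
  shows "AE \<omega> in M. (\<lambda>n. X (dyadic_floor n t) \<omega>) \<longlonglongrightarrow> X t \<omega>"
proof -
  define A where "A n = {\<omega>\<in>space M. q ^ n < \<bar>X t \<omega> - X (dyadic_floor n t) \<omega>\<bar>}" for n
  have A_meas [measurable]: "A n \<in> sets M" for n
  proof -
    have [measurable]: "X t \<in> borel_measurable M" "X (dyadic_floor n t) \<in> borel_measurable M"
      using t by (auto intro!: measurable_X dyadic_floor_nonneg)
    show ?thesis unfolding A_def by measurable
  qed
  have "AE \<omega> in M. \<forall>\<^sub>F n in sequentially. \<omega> \<in> space M - A n"
  proof (rule borel_cantelli_AE1)
    show "summable (\<lambda>n. prob (A n))"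
    proof (rule summable_comparison_test)
      show "\<exists>N. \<forall>n\<ge>N. norm (prob (A n)) \<le> C * r ^ n"
      proof (intro exI allI impI)
        fix n
        have "prob (A n) \<le> C * r ^ n / 2 ^ n"
          unfolding A_def using dyadic_floor_bounds[OF t, of n]
          by (intro prob_increment dyadic_floor_nonneg) auto
        also have "\<dots> \<le> C * r ^ n / 1"
          using C_nonneg r by (intro divide_left_mono) auto
        finally show "norm (prob (A n)) \<le> C * r ^ n"
          by simp
      qed
      show "summable (\<lambda>n. C * r ^ n)"
        using r by (intro summable_mult summable_geometric) auto
    qed
  qed (auto simp: less_top[symmetric])
  then show ?thesis
  proof eventually_elim
    case (elim \<omega>)
    have "(\<lambda>n. X (dyadic_floor n t) \<omega> - X t \<omega>) \<longlonglongrightarrow> 0"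
    proof (rule Lim_null_comparison)
      show "\<forall>\<^sub>F n in sequentially. norm (X (dyadic_floor n t) \<omega> - X t \<omega>) \<le> q ^ n"
        using elim by eventually_elim (auto simp: A_def not_less abs_minus_commute)
      show "(\<lambda>n. q ^ n) \<longlonglongrightarrow> 0"
        using q by (intro LIMSEQ_realpow_zero) auto
    qed
    then show ?case
      by (simp add: LIM_zero_iff)
  qed
qed

end

text \<open>Moment order and constants may change with \<gamma>, so the estimates are taken along a
  sequence of exponents increasing to a, which keeps the exceptional set null. The dyadic limit
  itself involves neither \<gamma> nor K, so one Y serves all of them.\<close>

lemma kolmogorov_chentsov:
  fixes X :: "real \<Rightarrow> 'a \<Rightarrow> real"
  assumes M: "prob_space M" and X: "\<And>t. 0 \<le> t \<Longrightarrow> X t \<in> borel_measurable M" and a: "0 < a"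
    and moments: "\<And>\<gamma>. 0 < \<gamma> \<Longrightarrow> \<gamma> < a \<Longrightarrow> \<exists>p C \<beta>. increment_moments M X p C \<beta> \<gamma>"
  shows "\<exists>Y. continuous_modification M X Y \<and>
           (\<forall>\<omega>\<in>space M. \<forall>\<gamma>\<in>{0<..<a}. locally_holder_on {0..} \<gamma> (\<lambda>t. Y t \<omega>))"
proof -
  define g where "g j = a * (1 - 1 / (real j + 2))" for j :: nat
  have g: "0 < g j" "g j < a" for j
    using a by (auto simp: g_def field_simps add_pos_nonneg)
  define good where "good \<omega> \<longleftrightarrow> (\<forall>j K. \<forall>\<^sub>F n in sequentially. \<forall>k < K * 2 ^ n.
      \<bar>X (real (Suc k) / 2 ^ n) \<omega> - X (real k / 2 ^ n) \<omega>\<bar> \<le> (2 powr - g j) ^ n)" for \<omega>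
  have "AE \<omega> in M. good \<omega>"
    unfolding good_def AE_all_countable
  proof (intro allI)
    fix j K
    obtain p C \<beta> where "increment_moments M X p C \<beta> (g j)"
      using moments g by blast
    then interpret increment_moments M X p C \<beta> "g j" .
    show "AE \<omega> in M. \<forall>\<^sub>F n in sequentially. \<forall>k < K * 2 ^ n.
      \<bar>X (real (Suc k) / 2 ^ n) \<omega> - X (real k / 2 ^ n) \<omega>\<bar> \<le> (2 powr - g j) ^ n"
      using AE_dyadic_increments[of K] unfolding q_def .
  qed
  then obtain N where N: "N \<in> null_sets M" "{\<omega>\<in>space M. \<not> good \<omega>} \<subseteq> N"
    unfolding eventually_ae_filter by blast
  \<comment> \<open>Setting Y to 0 on the measurable null set N makes every path continuous, as a
    continuous modification demands, and keeps Y measurable.\<close>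
  define Y where "Y t \<omega> = (if \<omega> \<in> N then 0 else lim (\<lambda>n. X (dyadic_floor n t) \<omega>))" for t \<omega>
  have holder: "locally_holder_on {0..} \<gamma> (\<lambda>t. Y t \<omega>)" if \<omega>: "\<omega> \<in> space M" and \<gamma>: "\<gamma> \<in> {0<..<a}" for \<omega> \<gamma>
  proof (cases "\<omega> \<in> N")
    case True
    show ?thesis
      by (rule locally_holder_onI) (auto simp: Y_def True intro!: exI[of _ 0])
  next
    case False
    have "\<exists>j. \<gamma> \<le> g j"
    proof -
      obtain j :: nat where j: "a / (a - \<gamma>) < real j"
        using reals_Archimedean2 by blast
      then have "a / (real j + 2) \<le> a - \<gamma>"
        using \<gamma> a by (simp add: field_simps)
      then show ?thesis
        by (intro exI[of _ j]) (simp add: g_def algebra_simps)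
    qed
    then obtain j where j: "\<gamma> \<le> g j" ..
    show ?thesis
    proof (rule locally_holder_onI)
      fix K :: nat
      have "good \<omega>"
        using N False \<omega> by auto
      then obtain m where m: "\<And>n k. m \<le> n \<Longrightarrow> k < K * 2 ^ n \<Longrightarrow>
         \<bar>X (real (Suc k) / 2 ^ n) \<omega> - X (real k / 2 ^ n) \<omega>\<bar> \<le> (2 powr - g j) ^ n"
        unfolding good_def eventually_sequentially by meson
      interpret dyadic_increments "\<lambda>t. X t \<omega>" K m "2 powr - \<gamma>"
      proof
        show "0 < (2::real) powr - \<gamma>" "(2::real) powr - \<gamma> < 1"
          using \<gamma> powr_less_mono[of "- \<gamma>" 0 2] by simp_all
        fix n k assume "m \<le> n" "k < K * 2 ^ n"
        from m[OF this] show "\<bar>X (real (Suc k) / 2 ^ n) \<omega> - X (real k / 2 ^ n) \<omega>\<bar> \<le> (2 powr - \<gamma>) ^ n"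
          using j by (elim order_trans) (auto intro!: power_mono powr_mono)
      qed
      have "(\<lambda>t. Y t \<omega>) = dyadic_limit"
        using False by (simp add: fun_eq_iff Y_def dyadic_limit_def)
      then show "\<exists>C. \<forall>s t. 0 \<le> s \<and> s < real K \<and> 0 \<le> t \<and> t < real K \<longrightarrow>
          \<bar>Y t \<omega> - Y s \<omega>\<bar> \<le> C * \<bar>t - s\<bar> powr \<gamma>"
        using dyadic_limit_holder[of \<gamma>] \<gamma> by (simp add: fun_eq_iff)
    qed
  qed
  have "continuous_modification M X Y"
    unfolding continuous_modification_def is_process_def
  proof (intro conjI allI impI ballI M)
    fix t :: real assume t: "0 \<le> t"
    have [measurable]: "N \<in> sets M"
      using N by blast
    have [measurable]: "X (dyadic_floor n t) \<in> borel_measurable M" for n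
      by (intro X dyadic_floor_nonneg)
    show "Y t \<in> borel_measurable M"
      unfolding Y_def by (intro measurable_If_set borel_measurable_lim_metric) auto
    \<comment> \<open>Any admissible exponent will do for the convergence at a fixed time.\<close>
    obtain p C \<beta> where "increment_moments M X p C \<beta> (g 0)"
      using moments g by blast
    then interpret increment_moments M X p C \<beta> "g 0" .
    show "AE \<omega> in M. Y t \<omega> = X t \<omega>"
      using AE_dyadic_floor_tendsto[OF t] AE_not_in[OF N(1)]
      by eventually_elim (simp add: Y_def limI)
  next
    fix \<omega> assume "\<omega> \<in> space M"
    from holder[OF this, of "g 0"] show "continuous_on {0..} (\<lambda>t. Y t \<omega>)"
      using g[of 0] by (intro locally_holder_on_imp_continuous_on[of "g 0"]) auto
  qed
  with holder show ?thesis by blast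
qed

subsection \<open>Small ball probabilities\<close>

text \<open>Gaussian smoothing: exp(-(K x)^2 / 2) is the standard normal characteristic function at
  K x, so by Fubini its expectation at Z is an average of the characteristic function of Z. On the
  event it is at least exp(-1/2), and Markov's inequality applies.\<close>

lemma (in prob_space) small_ball:
  fixes Z :: "'a \<Rightarrow> real"
  assumes [measurable]: "Z \<in> borel_measurable M" and K: "0 < K"
  shows "prob {\<omega>\<in>space M. \<bar>Z \<omega>\<bar> \<le> 1 / K} \<le>
    exp (1 / 2) * (LINT u|std_normal_distribution. cmod (CLINT \<omega>|M. iexp (K * u * Z \<omega>)))"
proof -
  let ?N = "std_normal_distribution"
  interpret N: real_distribution ?N
    by (rule real_dist_normal_dist)
  interpret P: pair_prob_space M ?N ..
  have "(\<integral>\<omega>. exp (- (K * Z \<omega>)\<^sup>2 / 2) \<partial>M) = Re (CLINT \<omega>|M. char ?N (K * Z \<omega>))"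
    by (simp add: char_std_normal_distribution)
  also have "(CLINT \<omega>|M. char ?N (K * Z \<omega>)) = (CLINT u|?N. CLINT \<omega>|M. iexp (K * Z \<omega> * u))"
    unfolding char_def
  proof (rule P.Fubini_integral[symmetric])
    show "complex_integrable (M \<Otimes>\<^sub>M ?N) (\<lambda>(\<omega>, u). iexp (K * Z \<omega> * u))"
      by (intro P.P.integrable_const_bound[of _ 1] AE_I2) (auto simp: case_prod_beta norm_exp_i_times simp del: of_real_mult)
  qed
  also have "Re \<dots> \<le> cmod \<dots>"
    by (rule complex_Re_le_cmod)
  also have "\<dots> \<le> (LINT u|?N. cmod (CLINT \<omega>|M. iexp (K * Z \<omega> * u)))"
    by (rule integral_norm_bound)
  finally have 1: "(\<integral>\<omega>. exp (- (K * Z \<omega>)\<^sup>2 / 2) \<partial>M) \<le> (LINT u|?N. cmod (CLINT \<omega>|M. iexp (K * u * Z \<omega>)))"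
    by (simp add: mult_ac)
  have int: "integrable M (\<lambda>\<omega>. exp (- (K * Z \<omega>)\<^sup>2 / 2))"
    by (intro integrable_const_bound[of _ 1]) auto
  have "prob {\<omega>\<in>space M. \<bar>Z \<omega>\<bar> \<le> 1 / K} \<le> prob {\<omega>\<in>space M. exp (- 1 / 2) \<le> exp (- (K * Z \<omega>)\<^sup>2 / 2)}"
  proof (intro finite_measure_mono subsetI)
    fix \<omega> assume \<omega>: "\<omega> \<in> {\<omega>\<in>space M. \<bar>Z \<omega>\<bar> \<le> 1 / K}"
    then have "\<bar>K * Z \<omega>\<bar> \<le> 1"
      using K by (simp add: abs_mult field_simps)
    then have "(K * Z \<omega>)\<^sup>2 \<le> 1"
      by (simp add: abs_square_le_1)
    with \<omega> show "\<omega> \<in> {\<omega>\<in>space M. exp (- 1 / 2) \<le> exp (- (K * Z \<omega>)\<^sup>2 / 2)}"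
      by simp
  qed measurable
  also have "\<dots> \<le> (\<integral>\<omega>. exp (- (K * Z \<omega>)\<^sup>2 / 2) \<partial>M) / exp (- 1 / 2)"
    by (intro integral_Markov_inequality_measure[where A = "space M"] int) auto
  also have "\<dots> \<le> (LINT u|?N. cmod (CLINT \<omega>|M. iexp (K * u * Z \<omega>))) / exp (- 1 / 2)"
    by (intro divide_right_mono 1) auto
  also have "\<dots> = exp (1 / 2) * (LINT u|?N. cmod (CLINT \<omega>|M. iexp (K * u * Z \<omega>)))"
    by (simp add: exp_minus field_simps)
  finally show ?thesis .
qed

text \<open>For fixed u \<noteq> 0 the bound drives the characteristic function at
  \<open>L n * u\<close> to 0; dominated convergence under the normal law then makes the right-hand
  side of \<open>small_ball\<close> vanish in the limit.\<close>

lemma (in prob_space) small_ball_tendsto_0: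
  fixes Z :: "nat \<Rightarrow> 'a \<Rightarrow> real"
  assumes [measurable]: "\<And>n. Z n \<in> borel_measurable M" and \<kappa>: "0 < \<kappa>"
    and K: "filterlim K at_top sequentially" and R: "filterlim R at_top sequentially"
    and bound: "\<And>n u. \<bar>u\<bar> \<le> R n \<Longrightarrow> cmod (CLINT \<omega>|M. iexp (u * Z n \<omega>)) \<le> exp (- \<kappa> * u\<^sup>2)"
  shows "(\<lambda>n. prob {\<omega>\<in>space M. \<bar>Z n \<omega>\<bar> \<le> 1 / K n}) \<longlonglongrightarrow> 0"
proof -
  let ?N = "std_normal_distribution"
  interpret N: real_distribution ?N
    by (rule real_dist_normal_dist)
  \<comment> \<open>Replacing \<open>K\<close> by a slower scale keeps \<open>L n * u\<close> eventually inside the range of \<open>bound\<close>.\<close>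
  define L where "L n = min (K n) (sqrt (R n))" for n
  have L: "filterlim L at_top sequentially"
    unfolding L_def filterlim_at_top
    using K filterlim_compose[OF sqrt_at_top R]
    unfolding filterlim_at_top by (auto intro: eventually_conj)
  let ?J = "\<lambda>n. LINT u|?N. cmod (CLINT \<omega>|M. iexp (L n * u * Z n \<omega>))"
  have J: "?J \<longlonglongrightarrow> (LINT u|?N. 0)"
  proof (rule integral_dominated_convergence[where w = "\<lambda>_. 1"])
    show "(\<lambda>u. cmod (CLINT \<omega>|M. iexp (L n * u * Z n \<omega>))) \<in> borel_measurable ?N" for n
      by measurable
    \<comment> \<open>At u = 0 the characteristic function is 1, so this point has to be excluded;
      it is null because the normal law has a density.\<close>
    have "AE u in ?N. u \<noteq> 0"
      by (subst AE_density) (auto intro: AE_mp[OF AE_lborel_singleton[of 0]])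
    then show "AE u in ?N. (\<lambda>n. cmod (CLINT \<omega>|M. iexp (L n * u * Z n \<omega>))) \<longlonglongrightarrow> 0"
    proof eventually_elim
      case (elim u)
      show ?case
      proof (rule Lim_null_comparison)
        \<comment> \<open>Both |u| and L n are then at most sqrt (R n), so that |L n u| is at most R
          n.\<close>
        have "\<forall>\<^sub>F n in sequentially. max 1 \<bar>u\<bar> \<le> sqrt (R n) \<and> 0 \<le> L n"
          using filterlim_compose[OF sqrt_at_top R] L unfolding filterlim_at_top
          by (intro eventually_conj) blast+
        then show "\<forall>\<^sub>F n in sequentially. norm (cmod (CLINT \<omega>|M. iexp (L n * u * Z n \<omega>))) \<le> exp (- \<kappa> * (L n * u)\<^sup>2)"
        proof eventually_elim
          case (elim n)
          then have "0 < R n"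
            by (smt (verit) real_sqrt_le_0_iff)
          have "\<bar>L n * u\<bar> \<le> sqrt (R n) * sqrt (R n)"
            unfolding abs_mult using elim by (intro mult_mono) (auto simp: L_def)
          then show ?case
            using bound[of "L n * u" n] \<open>0 < R n\<close> by simp
        qed
        have "filterlim (\<lambda>n. \<kappa> * u\<^sup>2 * (L n * L n)) at_top sequentially"
          using \<kappa> elim by (intro filterlim_tendsto_pos_mult_at_top[OF tendsto_const] filterlim_at_top_mult_at_top L) auto
        then have "filterlim (\<lambda>n. - (\<kappa> * u\<^sup>2 * (L n * L n))) at_bot sequentially"
          by (simp add: filterlim_uminus_at_bot)
        then have "((\<lambda>n. exp (- (\<kappa> * u\<^sup>2 * (L n * L n)))) \<longlongrightarrow> 0) sequentially"
          by (rule filterlim_compose[OF exp_at_bot])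
        then show "(\<lambda>n. exp (- \<kappa> * (L n * u)\<^sup>2)) \<longlonglongrightarrow> 0"
          by (simp add: power2_eq_square mult_ac)
      qed
    qed
    show "AE u in ?N. norm (cmod (CLINT \<omega>|M. iexp (L n * u * Z n \<omega>))) \<le> 1" for n
    proof (rule AE_I2)
      fix u
      have "cmod (CLINT \<omega>|M. iexp (L n * u * Z n \<omega>)) \<le> (\<integral>\<omega>. cmod (iexp (L n * u * Z n \<omega>)) \<partial>M)"
        by (rule integral_norm_bound)
      also have "\<dots> = 1"
        by (simp add: prob_space del: of_real_mult)
      finally show "norm (cmod (CLINT \<omega>|M. iexp (L n * u * Z n \<omega>))) \<le> 1"
        by simp
    qed
  qed auto
  show ?thesis
  proof (rule Lim_null_comparison)
    have "\<forall>\<^sub>F n in sequentially. 1 \<le> L n"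
      using L unfolding filterlim_at_top by blast
    then show "\<forall>\<^sub>F n in sequentially. norm (prob {\<omega>\<in>space M. \<bar>Z n \<omega>\<bar> \<le> 1 / K n}) \<le> exp (1 / 2) * ?J n"
    proof eventually_elim
      case (elim n)
      have "1 / K n \<le> 1 / L n"
        using elim by (intro divide_left_mono) (auto simp: L_def)
      then have "prob {\<omega>\<in>space M. \<bar>Z n \<omega>\<bar> \<le> 1 / K n} \<le> prob {\<omega>\<in>space M. \<bar>Z n \<omega>\<bar> \<le> 1 / L n}"
        by (intro finite_measure_mono) auto
      also have "\<dots> \<le> exp (1 / 2) * ?J n"
        using elim by (intro small_ball) auto
      finally show ?case by simp
    qed
    show "(\<lambda>n. exp (1 / 2) * ?J n) \<longlonglongrightarrow> 0"
      using tendsto_mult_left[OF J, of "exp (1 / 2)"] by simp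
  qed
qed

text \<open>With v the variance of the centred variable, the characteristic function is 1 - u^2 v /
  2 up to a cubic error, which near 0 is absorbed by part of the quadratic term.\<close>

lemma (in centered_moments) char_le_exp_near_0:
  assumes pos: "0 < (\<integral>\<omega>. (X \<omega>)\<^sup>2 \<partial>M)"
  shows "\<exists>\<kappa> \<eta>. 0 < \<kappa> \<and> 0 < \<eta> \<and> (\<forall>u. \<bar>u\<bar> \<le> \<eta> \<longrightarrow> cmod (CLINT \<omega>|M. iexp (u * X \<omega>)) \<le> exp (- \<kappa> * u\<^sup>2))"
proof -
  define v where "v = (\<integral>\<omega>. (X \<omega>)\<^sup>2 \<partial>M)"
  define B where "B = (\<integral>\<omega>. \<bar>X \<omega>\<bar> ^ 3 \<partial>M)"
  \<comment> \<open>The first entry gives u^2 v \<le> 1, hence a positive main term; the second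
    gives |u| B \<le> v/4, hence a cubic error of at most u^2 v / 24. The added 1s also give \<eta>
    \<le> 1 and a nonzero denominator.\<close>
  define \<eta> where "\<eta> = min (1 / (1 + v)) (v / (4 * (1 + B)))"
  interpret D: real_distribution "distr M borel X"
    by (rule real_distribution_distr) simp
  have int3: "integrable M (\<lambda>\<omega>. \<bar>X \<omega>\<bar> ^ 3)"
    using integrable_abs[OF moments_X[of 3]] by (simp add: power_abs)
  have v: "0 < v" using pos by (simp add: v_def)
  have B: "0 \<le> B" unfolding B_def by (intro integral_nonneg_AE) auto
  have \<eta>: "0 < \<eta>" "\<eta> \<le> 1" "\<eta> * v \<le> 1" "\<eta> * B \<le> v / 4"
  proof -
    show "0 < \<eta>" using v B by (auto simp: \<eta>_def)
    have 1: "\<eta> \<le> 1 / (1 + v)" "\<eta> \<le> v / (4 * (1 + B))"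
      by (auto simp: \<eta>_def)
    have "\<eta> * (1 + v) \<le> 1" "\<eta> * (1 + B) \<le> v / 4"
      using 1 v B by (simp_all add: pos_le_divide_eq mult_ac)
    moreover have "0 \<le> \<eta> * v" "0 \<le> \<eta> * B" using v B \<open>0 < \<eta>\<close> by auto
    ultimately show "\<eta> \<le> 1" "\<eta> * v \<le> 1" "\<eta> * B \<le> v / 4"
      using \<open>0 < \<eta>\<close> unfolding distrib_left mult_1_right by linarith+
  qed
  have "cmod (CLINT \<omega>|M. iexp (u * X \<omega>)) \<le> exp (- (v / 4) * u\<^sup>2)" if u: "\<bar>u\<bar> \<le> \<eta>" for u
  proof -
    have "cmod (char (distr M borel X) u - (1 - u\<^sup>2 * v / 2)) \<le>
        u\<^sup>2 / 6 * (\<integral>x. min (6 * x\<^sup>2) (\<bar>u\<bar> * \<bar>x\<bar> ^ 3) \<partial>distr M borel X)"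
      by (intro D.char_approx3) (use moments_X[of 1] moments_X[of 2] mean_X in
           \<open>auto simp: integrable_distr_eq integral_distr v_def\<close>)
    also have "\<dots> = u\<^sup>2 / 6 * (\<integral>\<omega>. min (6 * (X \<omega>)\<^sup>2) (\<bar>u\<bar> * \<bar>X \<omega>\<bar> ^ 3) \<partial>M)"
      by (subst integral_distr) auto
    also have "\<dots> \<le> u\<^sup>2 / 6 * (\<integral>\<omega>. \<bar>u\<bar> * \<bar>X \<omega>\<bar> ^ 3 \<partial>M)"
      using int3 by (intro mult_left_mono integral_mono') auto
    also have "\<dots> = u\<^sup>2 / 6 * (\<bar>u\<bar> * B)"
      by (simp add: B_def)
    also have "\<dots> \<le> u\<^sup>2 / 6 * (v / 4)"
      using mult_right_mono[OF u B] \<eta>(4) by (intro mult_left_mono) auto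
    finally have 1: "cmod (char (distr M borel X) u - (1 - u\<^sup>2 * v / 2)) \<le> u\<^sup>2 * v / 24"
      by simp
    have "\<bar>u\<bar> * \<bar>u\<bar> \<le> \<eta> * 1"
      using u \<eta> by (intro mult_mono) auto
    then have "u\<^sup>2 * v \<le> \<eta> * v"
      using v by (simp add: power2_eq_square)
    then have "u\<^sup>2 * v \<le> 1"
      using \<eta> by simp
    then have "cmod (of_real (1 - u\<^sup>2 * v / 2)) = 1 - u\<^sup>2 * v / 2"
      unfolding norm_of_real by simp
    then have "cmod (char (distr M borel X) u) \<le> 1 - u\<^sup>2 * v / 2 + u\<^sup>2 * v / 24"
      using 1 norm_triangle_sub[of "char (distr M borel X) u" "1 - u\<^sup>2 * v / 2"] by (simp add: mult.commute)
    \<comment> \<open>There is slack here, since 1/2 - 1/24 exceeds 1/4.\<close>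
    also have "\<dots> \<le> 1 + (- (v / 4) * u\<^sup>2)"
      using v by (simp add: algebra_simps)
    also have "\<dots> \<le> exp (- (v / 4) * u\<^sup>2)"
      by (rule exp_ge_add_one_self)
    finally show ?thesis
      by (simp add: char_def integral_distr)
  qed
  then show ?thesis
    using v \<eta>(1) by (intro exI[of _ "v / 4"] exI[of _ \<eta>]) auto
qed

text \<open>The modulus sees only real parts: the jump integrand has real part cos(u x) - 1 \<le> 0,
  so the Gaussian factor alone bounds the characteristic function.\<close>

lemma has_gaussian_component_char_le:
  assumes "has_gaussian_component \<mu>"
  shows "\<exists>\<kappa>>0. \<forall>u. cmod (char \<mu> u) \<le> exp (- \<kappa> * u\<^sup>2)"
proof -
  obtain b v \<Lambda> where lk: "levy_khintchine \<mu> b v \<Lambda>" and v: "0 < v"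
    using assms unfolding has_gaussian_component_def by blast
  have "cmod (char \<mu> u) \<le> exp (- (v / 2) * u\<^sup>2)" for u
  proof -
    let ?f = "\<lambda>x. iexp (u * x) - 1 - \<i> * of_real (u * x * indicator {-1..1} x)"
    have "Re (CLINT x|\<Lambda>. ?f x) \<le> 0"
    proof (cases "complex_integrable \<Lambda> ?f")
      case True
      then have "Re (CLINT x|\<Lambda>. ?f x) = (LINT x|\<Lambda>. Re (?f x))"
        by (rule integral_Re[symmetric])
      also have "\<dots> \<le> 0"
      proof -
        have "0 \<le> (LINT x|\<Lambda>. - Re (?f x))"
          by (intro integral_nonneg_AE AE_I2) (simp add: Re_exp)
        then show ?thesis
          by (simp only: Bochner_Integration.integral_minus)
      qed
      finally show ?thesis .
    next
      case False
      \<comment> \<open>The integral takes its default value 0 here, which also satisfies the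
        inequality.\<close>
      then show ?thesis by (simp add: not_integrable_integral_eq)
    qed
    moreover have "cmod (char \<mu> u) = exp (Re (\<i> * of_real (b * u) - of_real (v * u\<^sup>2 / 2) + (CLINT x|\<Lambda>. ?f x)))"
      using lk unfolding levy_khintchine_def norm_exp_eq_Re[symmetric] by metis
    ultimately show ?thesis
      by (simp add: mult.commute)
  qed
  then show ?thesis
    using v by (intro exI[of _ "v / 2"]) auto
qed

subsection \<open>Dilatively stable processes\<close>

lemma measurable_restrict_singleton:
  assumes "X t \<in> borel_measurable M"
  shows "(\<lambda>\<omega>. \<lambda>s\<in>{t}. X s \<omega>) \<in> M \<rightarrow>\<^sub>M Pi\<^sub>M {t} (\<lambda>_. borel)"
  using assms by (intro measurable_restrict) auto

lemma distr_component_fdd: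
  assumes X: "X t \<in> borel_measurable M"
  shows "distr (fdd M X {t}) borel (\<lambda>f. f t) = distr M borel (X t)"
  unfolding fdd_def by (subst distr_distr[OF _ measurable_restrict_singleton[of X, OF X]]) (auto simp: o_def)

lemma fd_equal_imp_distr_eq:
  assumes "fd_equal M X N Y" "0 \<le> t" "X t \<in> borel_measurable M" "Y t \<in> borel_measurable N"
  shows "distr M borel (X t) = distr N borel (Y t)"
proof -
  have "fdd M X {t} = fdd N Y {t}"
    using assms(1,2) unfolding fd_equal_def by auto
  then show ?thesis
    using distr_component_fdd[of X t M] distr_component_fdd[of Y t N] assms(3,4) by simp
qed

lemma char_distr:
  assumes [measurable]: "Z \<in> borel_measurable M"
  shows "char (distr M borel Z) u = (CLINT \<omega>|M. iexp (u * Z \<omega>))"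
  unfolding char_def by (subst integral_distr) auto

lemma fd_char_singleton:
  assumes X: "X t \<in> borel_measurable M"
  shows "fd_char {t} (fdd M X {t}) (\<lambda>_. u) = (CLINT \<omega>|M. iexp (u * X t \<omega>))"
  unfolding fd_char_def fdd_def by (subst integral_distr[OF measurable_restrict_singleton[of X, OF X]]) auto

text \<open>The consequences of dilative stability and stationary increments in terms of single
  variables. The auxiliary space carrying the convolution power is gone; \<open>var_pos\<close> is
  what non-Gaussianity of X(1) contributes.\<close>

locale dilative_process = prob_space M for M :: "'a measure" +
  fixes X :: "real \<Rightarrow> 'a \<Rightarrow> real" and H \<delta> :: real
  assumes measurable_X: "0 \<le> t \<Longrightarrow> X t \<in> borel_measurable M"
    and moments_X: "0 \<le> t \<Longrightarrow> integrable M (\<lambda>\<omega>. X t \<omega> ^ n)"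
    and mean_X: "0 \<le> t \<Longrightarrow> (\<integral>\<omega>. X t \<omega> \<partial>M) = 0"
    and start: "AE \<omega> in M. X 0 \<omega> = 0"
    and scaling: "0 < T \<Longrightarrow> char_power M (X 1) (T powr \<delta>) (\<lambda>\<omega>. X T \<omega> / T powr (H - \<delta> / 2))"
    and increments: "0 \<le> s \<Longrightarrow> 0 \<le> t \<Longrightarrow> distr M borel (\<lambda>\<omega>. X (t + s) \<omega> - X s \<omega>) = distr M borel (X t)"
    and var_pos: "0 < (\<integral>\<omega>. (X 1 \<omega>)\<^sup>2 \<partial>M)"
    and H_pos: "0 < H"
begin

sublocale X1: centered_moments M "X 1"
  by unfold_locales (auto intro: measurable_X moments_X mean_X)

lemma integral_increment:
  fixes g :: "real \<Rightarrow> real"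
  assumes "0 \<le> s" "0 \<le> t" and [measurable]: "g \<in> borel_measurable borel"
  shows "(\<integral>\<omega>. g (X (t + s) \<omega> - X s \<omega>) \<partial>M) = (\<integral>\<omega>. g (X t \<omega>) \<partial>M)"
    and "integrable M (\<lambda>\<omega>. g (X (t + s) \<omega> - X s \<omega>)) \<longleftrightarrow> integrable M (\<lambda>\<omega>. g (X t \<omega>))"
proof -
  have [measurable]: "X (t + s) \<in> borel_measurable M" "X s \<in> borel_measurable M" "X t \<in> borel_measurable M"
    using assms by (auto intro: measurable_X)
  show "(\<integral>\<omega>. g (X (t + s) \<omega> - X s \<omega>) \<partial>M) = (\<integral>\<omega>. g (X t \<omega>) \<partial>M)"
    using arg_cong[OF increments[OF assms(1,2)], of "\<lambda>D. integral\<^sup>L D g"] by (simp add: integral_distr)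
  show "integrable M (\<lambda>\<omega>. g (X (t + s) \<omega> - X s \<omega>)) \<longleftrightarrow> integrable M (\<lambda>\<omega>. g (X t \<omega>))"
    using arg_cong[OF increments[OF assms(1,2)], of "\<lambda>D. integrable D g"] by (simp add: integrable_distr_eq)
qed

lemma moment_eq_scaled:
  assumes "0 < T"
  shows "(\<integral>\<omega>. X T \<omega> ^ n \<partial>M) = T powr (n * (H - \<delta> / 2)) * (\<integral>\<omega>. (X T \<omega> / T powr (H - \<delta> / 2)) ^ n \<partial>M)"
proof -
  have "(T powr (H - \<delta> / 2)) ^ n = T powr (n * (H - \<delta> / 2))"
    using assms by (simp add: powr_power mult.commute)
  then show ?thesis
    using assms by (simp add: power_divide)
qed

lemma second_moment:
  assumes "0 < T"
  shows "(\<integral>\<omega>. (X T \<omega>)\<^sup>2 \<partial>M) = T powr (2 * H) * (\<integral>\<omega>. (X 1 \<omega>)\<^sup>2 \<partial>M)"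
  unfolding moment_eq_scaled[OF assms] X1.second_moment_char_power[OF scaling[OF assms]]
  using assms by (simp add: algebra_simps flip: powr_add)

text \<open>The standard deviation is proportional to \<open>t\<^sup>H\<close>, and subadditive by stationarity of the increments.\<close>

lemma H_le_1: "H \<le> 1"
proof -
  define v where "v = (\<integral>\<omega>. (X 1 \<omega>)\<^sup>2 \<partial>M)"
  have int: "integrable M (\<lambda>\<omega>. (X 1 \<omega>)\<^sup>2)" "integrable M (\<lambda>\<omega>. (X (1 + 1) \<omega> - X 1 \<omega>)\<^sup>2)"
    using integral_increment(2)[of 1 1 "\<lambda>x. x\<^sup>2"] moments_X[of 1 2] by auto
  have "2 powr (2 * H) * v = (\<integral>\<omega>. (X 2 \<omega>)\<^sup>2 \<partial>M)"
    unfolding v_def by (rule second_moment[symmetric]) simp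
  also have "\<dots> \<le> (\<integral>\<omega>. 2 * (X 1 \<omega>)\<^sup>2 + 2 * (X (1 + 1) \<omega> - X 1 \<omega>)\<^sup>2 \<partial>M)"
  proof (rule integral_mono')
    fix \<omega>
    \<comment> \<open>This is (a - b)^2 for a = X(1) and b = X(2) - X(1), which turns into (a + b)^2
      \<le> 2 a^2 + 2 b^2.\<close>
    have "0 \<le> (X 2 \<omega> - 2 * X 1 \<omega>)\<^sup>2"
      by simp
    then show "(X 2 \<omega>)\<^sup>2 \<le> 2 * (X 1 \<omega>)\<^sup>2 + 2 * (X (1 + 1) \<omega> - X 1 \<omega>)\<^sup>2"
      by (simp add: power2_eq_square algebra_simps)
  qed (use int in auto)
  also have "\<dots> = 2 * v + 2 * (\<integral>\<omega>. (X (1 + 1) \<omega> - X 1 \<omega>)\<^sup>2 \<partial>M)"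
    using int by (simp add: v_def)
  also have "(\<integral>\<omega>. (X (1 + 1) \<omega> - X 1 \<omega>)\<^sup>2 \<partial>M) = v"
    unfolding v_def by (rule integral_increment(1)) auto
  finally have "2 powr (2 * H) \<le> 2 powr 2"
    using var_pos unfolding v_def[symmetric] by simp
  then have "2 * H \<le> 2"
    by (subst (asm) powr_le_cancel_iff) auto
  then show ?thesis
    by simp
qed

text \<open>For t \<le> 1 and \<delta> < 0 the power c = t^\<delta> is at least 1, and c^(n/2)
  cancels the term -n \<delta>/2 in the exponent.\<close>

lemma moment_bound_neg:
  assumes "\<delta> < 0"
  shows "\<exists>A. \<forall>t. 0 < t \<and> t \<le> 1 \<longrightarrow> (\<integral>\<omega>. X t \<omega> ^ n \<partial>M) \<le> A * t powr (n * H)"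
proof -
  obtain A where A: "\<And>c Z. 1 \<le> c \<Longrightarrow> char_power M (X 1) c Z \<Longrightarrow> \<bar>\<integral>\<omega>. Z \<omega> ^ n \<partial>M\<bar> \<le> A * c powr (n / 2)"
    using X1.moment_bound_ge_1 by blast
  have "(\<integral>\<omega>. X t \<omega> ^ n \<partial>M) \<le> A * t powr (n * H)" if t: "0 < t" "t \<le> 1" for t
  proof -
    have "1 \<le> t powr \<delta>"
      using powr_mono'[of \<delta> 0 t] t assms by simp
    from A[OF this scaling[OF t(1)]]
    have "(\<integral>\<omega>. X t \<omega> ^ n \<partial>M) \<le> t powr (n * (H - \<delta> / 2)) * (A * (t powr \<delta>) powr (n / 2))"
      unfolding moment_eq_scaled[OF t(1)] by (intro mult_left_mono) auto
    also have "\<dots> = A * (t powr (n * (H - \<delta> / 2)) * t powr (\<delta> * (n / 2)))"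
      by (simp add: powr_powr)
    also have "t powr (n * (H - \<delta> / 2)) * t powr (\<delta> * (n / 2)) = t powr (n * H)"
      unfolding powr_add[symmetric] by (simp add: algebra_simps)
    finally show ?thesis .
  qed
  then show ?thesis by blast
qed

text \<open>Here c = t^\<delta> is at most 1 and contributes just the summand \<delta> of the
  exponent.\<close>

lemma moment_bound_nonneg:
  assumes "0 \<le> \<delta>" "0 < n"
  shows "\<exists>A. \<forall>t. 0 < t \<and> t \<le> 1 \<longrightarrow> (\<integral>\<omega>. X t \<omega> ^ n \<partial>M) \<le> A * t powr (n * (H - \<delta> / 2) + \<delta>)"
proof -
  obtain A where A: "\<And>c Z. 0 \<le> c \<Longrightarrow> c \<le> 1 \<Longrightarrow> char_power M (X 1) c Z \<Longrightarrow> \<bar>\<integral>\<omega>. Z \<omega> ^ n \<partial>M\<bar> \<le> A * c"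
    using X1.moment_bound_le_1[OF assms(2)] by blast
  have "(\<integral>\<omega>. X t \<omega> ^ n \<partial>M) \<le> A * t powr (n * (H - \<delta> / 2) + \<delta>)" if t: "0 < t" "t \<le> 1" for t
  proof -
    have "t powr \<delta> \<le> 1"
      using powr_mono'[of 0 \<delta> t] t assms by simp
    from A[OF _ this scaling[OF t(1)]]
    have "(\<integral>\<omega>. X t \<omega> ^ n \<partial>M) \<le> t powr (n * (H - \<delta> / 2)) * (A * t powr \<delta>)"
      unfolding moment_eq_scaled[OF t(1)] by (intro mult_left_mono) auto
    then show ?thesis
      by (simp add: powr_add mult_ac)
  qed
  then show ?thesis by blast
qed

text \<open>Moments of increments are moments of X by stationarity, and an even order makes absolute
  values disappear. Coinciding times are treated apart, since the hypothesis on A speaks of positive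
  times.\<close>

lemma increment_momentsI:
  fixes p :: nat and A \<beta> \<gamma> :: real
  assumes p: "even p" "0 < p" and \<gamma>: "0 < \<gamma>" "\<gamma> * p < \<beta>"
    and A: "\<forall>t. 0 < t \<and> t \<le> 1 \<longrightarrow> (\<integral>\<omega>. X t \<omega> ^ p \<partial>M) \<le> A * t powr (1 + \<beta>)"
  shows "increment_moments M X p A \<beta> \<gamma>"
proof unfold_locales
  fix s t :: real assume st: "0 \<le> s" "s \<le> t" "t \<le> s + 1"
  have abs_p: "\<bar>x\<bar> ^ p = x ^ p" for x :: real
    using p(1) by (rule power_even_abs)
  show "integrable M (\<lambda>\<omega>. \<bar>X t \<omega> - X s \<omega>\<bar> ^ p)"
    using integral_increment(2)[of s "t - s" "\<lambda>x. x ^ p"] moments_X[of "t - s" p] st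
    by (simp add: abs_p)
  show "(\<integral>\<omega>. \<bar>X t \<omega> - X s \<omega>\<bar> ^ p \<partial>M) \<le> A * (t - s) powr (1 + \<beta>)"
  proof (cases "s = t")
    case True
    then show ?thesis using p by (simp add: power_0_left)
  next
    case False
    then show ?thesis
      using integral_increment(1)[of s "t - s" "\<lambda>x. x ^ p"] A[rule_format, of "t - s"] st
      by (simp add: abs_p)
  qed
qed (use assms measurable_X in auto)

text \<open>For \<delta> = 2H the middle formula would give 0; the last branch comes from the second
  moment instead.\<close>

definition holder_bound :: real where
  "holder_bound = (if \<delta> < 0 then H else if \<delta> < 2 * H then H - \<delta> / 2 else H - 1 / 2)"

lemma large_even_exponent:
  fixes a b :: real
  assumes "0 < a"
  shows "\<exists>p :: nat. even p \<and> 0 < p \<and> b < p * a"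
proof -
  obtain m :: nat where "b / a < real m"
    using reals_Archimedean2 by blast
  then have "b < m * a"
    using assms by (simp add: divide_less_eq)
  also have "\<dots> \<le> (2 * (m + 1)) * a"
    using assms by (intro mult_right_mono) auto
  finally show ?thesis
    by (intro exI[of _ "2 * (m + 1)"]) auto
qed

text \<open>In the first two cases \<gamma> p < \<beta> amounts to 1 < p(H-\<gamma>) and 1-\<delta>
  < p(H-\<delta>/2-\<gamma>), solvable by a large even p. If \<delta> = 2H, raising p leaves \<beta>
  = 2H-1 unchanged while tightening the condition, so p = 2 is the choice.\<close>

lemma ex_increment_moments:
  assumes "\<delta> \<noteq> 2 * H \<or> H > 1 / 2" "\<delta> \<le> 2 * H" "0 < \<gamma>" "\<gamma> < holder_bound"
  shows "\<exists>p C \<beta>. increment_moments M X p C \<beta> \<gamma>"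
proof -
  consider "\<delta> < 0" | "0 \<le> \<delta>" "\<delta> < 2 * H" | "0 \<le> \<delta>" "\<delta> = 2 * H"
    using assms(2) H_pos by linarith
  then show ?thesis
  proof cases
    case 1
    then obtain p :: nat where p: "even p" "0 < p" "1 < p * (H - \<gamma>)"
      using large_even_exponent[of "H - \<gamma>" 1] assms(4) by (auto simp: holder_bound_def)
    obtain A where "\<forall>t. 0 < t \<and> t \<le> 1 \<longrightarrow> (\<integral>\<omega>. X t \<omega> ^ p \<partial>M) \<le> A * t powr (p * H)"
      using moment_bound_neg[OF 1, of p] by blast
    then have "increment_moments M X p A (p * H - 1) \<gamma>"
      using p assms(3) by (intro increment_momentsI[OF p(1,2)]) (auto simp: algebra_simps)
    then show ?thesis by blast
  next
    case 2
    then obtain p :: nat where p: "even p" "0 < p" "1 - \<delta> < p * (H - \<delta> / 2 - \<gamma>)"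
      using large_even_exponent[of "H - \<delta> / 2 - \<gamma>" "1 - \<delta>"] assms(4) by (auto simp: holder_bound_def)
    obtain A where "\<forall>t. 0 < t \<and> t \<le> 1 \<longrightarrow> (\<integral>\<omega>. X t \<omega> ^ p \<partial>M) \<le> A * t powr (p * (H - \<delta> / 2) + \<delta>)"
      using moment_bound_nonneg[OF 2(1) p(2)] by blast
    then have "increment_moments M X p A (p * (H - \<delta> / 2) + \<delta> - 1) \<gamma>"
      using p assms(3) by (intro increment_momentsI[OF p(1,2)]) (auto simp: algebra_simps)
    then show ?thesis by blast
  next
    case 3
    have "(\<integral>\<omega>. X t \<omega> ^ 2 \<partial>M) \<le> (\<integral>\<omega>. (X 1 \<omega>)\<^sup>2 \<partial>M) * t powr (1 + (2 * H - 1))" if "0 < t" for t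
      using second_moment[OF that] by simp
    moreover have "\<gamma> < H - 1 / 2"
      using assms(4) 3 unfolding holder_bound_def by simp
    ultimately have "increment_moments M X 2 (\<integral>\<omega>. (X 1 \<omega>)\<^sup>2 \<partial>M) (2 * H - 1) \<gamma>"
      using assms(3) by (intro increment_momentsI) auto
    then show ?thesis by blast
  qed
qed

end

text \<open>Everything is read off from one-point sets of times: \<open>{1}\<close> in the scaling
  relation, \<open>{t}\<close> for the increments.\<close>

lemma dilative_processI:
  assumes ds: "dilatively_stable H \<delta> M X" and si: "stationary_increments M X" and zm: "zero_mean M X"
  shows "dilative_process M X H \<delta>"
proof -
  have M: "prob_space M" and X: "\<And>t. 0 \<le> t \<Longrightarrow> X t \<in> borel_measurable M"
    using ds unfolding dilatively_stable_def is_process_def by auto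
  interpret prob_space M by fact
  have start: "AE \<omega> in M. X 0 \<omega> = 0" and H: "0 < H"
    and mom: "\<And>t n. 0 \<le> t \<Longrightarrow> integrable M (\<lambda>\<omega>. X t \<omega> ^ n)"
    and ng: "\<not> gaussian_law (distr M borel (X 1))"
    using ds unfolding dilatively_stable_def by auto
  note [measurable] = X[of 0] X[of 1]
  have scaling: "char_power M (X 1) (T powr \<delta>) (\<lambda>\<omega>. X T \<omega> / T powr (H - \<delta> / 2))" if T: "0 < T" for T
  proof -
    define a where "a = T powr (H - \<delta> / 2)"
    have a: "0 < a" using T by (simp add: a_def)
    have [measurable]: "X T \<in> borel_measurable M" using T X by simp
    obtain N :: "(real \<Rightarrow> real) measure" and Y where
      Y: "process_convolution_power M X (T powr \<delta>) N Y"
      and eq: "fd_equal M (\<lambda>t. X (T * t)) N (\<lambda>t \<omega>. a * Y t \<omega>)"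
      using ds T unfolding dilatively_stable_def a_def by blast
    have [measurable]: "Y 1 \<in> borel_measurable N"
      using Y unfolding process_convolution_power_def is_process_def by simp
    have "convolution_power {1} (fdd M X {1}) (T powr \<delta>) (fdd N Y {1})"
      using Y unfolding process_convolution_power_def by simp
    then obtain \<psi> :: "(real \<Rightarrow> real) \<Rightarrow> complex" where \<psi>: "continuous_on UNIV \<psi>"
      "\<And>u. fd_char {1} (fdd M X {1}) u = exp (\<psi> u)"
      "\<And>u. fd_char {1} (fdd N Y {1}) u = exp (of_real (T powr \<delta>) * \<psi> u)"
      unfolding convolution_power_def by blast
    have distr: "distr M borel (X T) = distr N borel (\<lambda>\<omega>. a * Y 1 \<omega>)"
      using fd_equal_imp_distr_eq[OF eq, of 1] by simp
    \<comment> \<open>Over the index set \<open>{1}\<close> only the value of the argument at 1 is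
      read, so constant functions embed the real line into the domain of \<psi>.\<close>
    have Z: "(CLINT \<omega>|M. iexp (u * (X T \<omega> / a))) = exp (of_real (T powr \<delta>) * \<psi> (\<lambda>_. u))" for u
    proof -
      have "(CLINT \<omega>|M. iexp (u * (X T \<omega> / a))) = char (distr M borel (X T)) (u / a)"
        by (simp add: char_distr)
      also have "\<dots> = (CLINT \<omega>|N. iexp (u / a * (a * Y 1 \<omega>)))"
        unfolding distr by (rule char_distr) measurable
      also have "\<dots> = fd_char {1} (fdd N Y {1}) (\<lambda>_. u)"
        using a by (simp add: fd_char_singleton)
      finally show ?thesis by (simp add: \<psi>(3))
    qed
    have X1: "(CLINT \<omega>|M. iexp (u * X 1 \<omega>)) = exp (\<psi> (\<lambda>_. u))" for u
      using \<psi>(2)[of "\<lambda>_. u"] by (simp add: fd_char_singleton)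
    have cont: "continuous_on UNIV (\<lambda>u. \<psi> (\<lambda>_. u))"
      by (rule continuous_on_compose2[OF \<psi>(1)]) (auto intro: continuous_on_coordinatewise_then_product)
    have int: "integrable M (\<lambda>\<omega>. (X T \<omega> / a) ^ n)" for n
      using mom[of T n] T by (simp add: power_divide)
    show ?thesis
      unfolding char_power_def a_def[symmetric]
      by (intro conjI allI exI[of _ "\<lambda>u. \<psi> (\<lambda>_. u)"] cont Z X1 int) measurable
  qed
  have increments: "distr M borel (\<lambda>\<omega>. X (t + s) \<omega> - X s \<omega>) = distr M borel (X t)" if st: "0 \<le> s" "0 \<le> t" for s t
  proof -
    have [measurable]: "X (t + s) \<in> borel_measurable M" "X s \<in> borel_measurable M" "X t \<in> borel_measurable M"
      using st X by auto
    have "distr M borel (\<lambda>\<omega>. X (t + s) \<omega> - X s \<omega>) = distr M borel (\<lambda>\<omega>. X t \<omega> - X 0 \<omega>)"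
      using si st unfolding stationary_increments_def
      by (intro fd_equal_imp_distr_eq[where X = "\<lambda>t \<omega>. X (t + s) \<omega> - X s \<omega>" and Y = "\<lambda>t \<omega>. X t \<omega> - X 0 \<omega>"]) auto
    also have "\<dots> = distr M borel (X t)"
    proof (rule distr_cong_AE)
      show "AE \<omega> in M. X t \<omega> - X 0 \<omega> = X t \<omega>"
        using start by eventually_elim simp
    qed auto
    finally show ?thesis .
  qed
  \<comment> \<open>A vanishing variance would make the law of X(1) a point mass, and
    \<open>gaussian_law\<close> covers point masses.\<close>
  have "(\<integral>\<omega>. (X 1 \<omega>)\<^sup>2 \<partial>M) \<noteq> 0"
  proof
    assume "(\<integral>\<omega>. (X 1 \<omega>)\<^sup>2 \<partial>M) = 0"
    then have "AE \<omega> in M. X 1 \<omega> = 0"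
      using integral_nonneg_eq_0_iff_AE[of M "\<lambda>\<omega>. (X 1 \<omega>)\<^sup>2"] mom[of 1 2] by simp
    then have "distr M borel (X 1) = distr M borel (\<lambda>_. 0)"
      by (intro distr_cong_AE) auto
    also have "\<dots> = return borel 0"
      by simp
    finally show False
      using ng unfolding gaussian_law_def by blast
  qed
  moreover have "0 \<le> (\<integral>\<omega>. (X 1 \<omega>)\<^sup>2 \<partial>M)"
    by (intro integral_nonneg_AE) auto
  ultimately have var: "0 < (\<integral>\<omega>. (X 1 \<omega>)\<^sup>2 \<partial>M)"
    by linarith
  show ?thesis
    using X mom start H scaling increments var zm
    unfolding zero_mean_def by unfold_locales blast+
qed

section \<open>Local Hoelder exponents and uniqueness of continuous modifications\<close>

lemma locally_holder_on_cong:
  assumes "\<And>t. t \<in> I \<Longrightarrow> f t = g t"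
  shows "locally_holder_on I \<gamma> f = locally_holder_on I \<gamma> g"
proof -
  have "{\<bar>f t - f s\<bar> / \<bar>t - s\<bar> powr \<gamma> | t s. t \<in> J \<and> s \<in> J \<and> t \<noteq> s} =
        {\<bar>g t - g s\<bar> / \<bar>t - s\<bar> powr \<gamma> | t s. t \<in> J \<and> s \<in> J \<and> t \<noteq> s}" if "J \<subseteq> I" for J
  proof -
    have eq: "f t = g t" if "t \<in> J" for t
      using that \<open>J \<subseteq> I\<close> assms by blast
    show ?thesis
      by (intro Collect_cong iff_exI) (auto simp: eq)
  qed
  then show ?thesis
    unfolding locally_holder_on_def by simp
qed

text \<open>The exponent is a supremum over a subset of (0,1], so no a > 1 can be reached; for the
  process, a \<le> 1 is secured by \<open>H_le_1\<close>.\<close>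

lemma local_holder_exponent_ge:
  assumes a: "0 < a" "a \<le> 1" and holder: "\<And>\<gamma>. \<gamma> \<in> {0<..<a} \<Longrightarrow> locally_holder_on I \<gamma> f"
  shows "a \<le> local_holder_exponent I f"
proof -
  define G where "G = {\<gamma>. 0 < \<gamma> \<and> \<gamma> \<le> 1 \<and> locally_holder_on I \<gamma> f}"
  have G: "\<gamma> \<in> G" if "0 < \<gamma>" "\<gamma> < a" for \<gamma>
    using that a holder[of \<gamma>] by (auto simp: G_def)
  have "bdd_above G"
    by (rule bdd_aboveI[of _ 1]) (auto simp: G_def)
  then have "a \<le> Sup G"
    by (intro dense_le_bounded[OF a(1)] cSup_upper G)
  moreover have "G \<noteq> {}"
    using G[of "a / 2"] a by auto
  ultimately show ?thesis
    by (simp add: local_holder_exponent_def flip: G_def)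
qed

lemma local_holder_exponent_le:
  assumes "0 \<le> a" and "\<And>\<gamma>. a < \<gamma> \<Longrightarrow> \<not> locally_holder_on I \<gamma> f"
  shows "local_holder_exponent I f \<le> a"
proof -
  define G where "G = {\<gamma>. 0 < \<gamma> \<and> \<gamma> \<le> 1 \<and> locally_holder_on I \<gamma> f}"
  have "Sup G \<le> a" if "G \<noteq> {}"
    using that
  proof (rule cSup_least)
    fix \<gamma> assume "\<gamma> \<in> G"
    then show "\<gamma> \<le> a"
      using assms(2) unfolding G_def not_less[symmetric] by blast
  qed
  then show ?thesis
    using assms(1) by (simp add: local_holder_exponent_def flip: G_def)
qed

lemma dyadic_floor_tendsto:
  assumes "0 \<le> t"
  shows "(\<lambda>n. dyadic_floor n t) \<longlonglongrightarrow> t"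
proof (rule LIM_zero_cancel, rule Lim_null_comparison)
  show "\<forall>\<^sub>F n in sequentially. norm (dyadic_floor n t - t) \<le> (1 / 2) ^ n"
  proof (intro always_eventually allI)
    fix n show "norm (dyadic_floor n t - t) \<le> (1 / 2) ^ n"
      using dyadic_floor_bounds[OF assms, of n] by simp
  qed
  show "(\<lambda>n. (1 / 2) ^ n :: real) \<longlonglongrightarrow> 0"
    by (intro LIMSEQ_realpow_zero) auto
qed

text \<open>Agreement at the countably many dyadic times is almost sure, and continuity extends it
  to all times. This passes regularity from the constructed modification to any other.\<close>

lemma continuous_modification_unique:
  assumes "continuous_modification M X Y" "continuous_modification M X Y'"
  shows "AE \<omega> in M. \<forall>t\<ge>0. Y t \<omega> = Y' t \<omega>"
proof -
  have "AE \<omega> in M. Y (real k / 2 ^ n) \<omega> = Y' (real k / 2 ^ n) \<omega>" for k n :: nat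
  proof -
    have "0 \<le> real k / 2 ^ n" by simp
    then have "AE \<omega> in M. Y (real k / 2 ^ n) \<omega> = X (real k / 2 ^ n) \<omega>"
      "AE \<omega> in M. Y' (real k / 2 ^ n) \<omega> = X (real k / 2 ^ n) \<omega>"
      using assms unfolding continuous_modification_def by blast+
    then show ?thesis by eventually_elim simp
  qed
  then have "AE \<omega> in M. \<forall>k n :: nat. Y (real k / 2 ^ n) \<omega> = Y' (real k / 2 ^ n) \<omega>"
    by (simp add: AE_all_countable)
  then show ?thesis
    using AE_space
  proof eventually_elim
    case (elim \<omega>)
    show ?case
    proof (intro allI impI)
      fix t :: real assume t: "0 \<le> t"
      have lim: "(\<lambda>n. Z (dyadic_floor n t) \<omega>) \<longlonglongrightarrow> Z t \<omega>" if "continuous_modification M X Z" for Z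
      proof -
        have "continuous_on {0..} (\<lambda>t. Z t \<omega>)"
          using that elim unfolding continuous_modification_def by blast
        then show ?thesis
          using t by (rule continuous_on_tendsto_compose[OF _ dyadic_floor_tendsto])
            (use t in \<open>auto simp: dyadic_floor_nonneg\<close>)
      qed
      have "(\<lambda>n. Y (dyadic_floor n t) \<omega>) = (\<lambda>n. Y' (dyadic_floor n t) \<omega>)"
        using elim unfolding dyadic_floor_def by blast
      with lim[OF assms(1)] lim[OF assms(2)] show "Y t \<omega> = Y' t \<omega>"
        by (metis LIMSEQ_unique)
    qed
  qed
qed

text \<open>|exp (c \<psi>)| = exp (c Re \<psi>) = |exp \<psi>|^c: on moduli the power is
  unambiguous.\<close>

lemma char_power_norm:
  assumes "char_power M X c Z"
  shows "cmod (CLINT \<omega>|M. iexp (u * Z \<omega>)) = cmod (CLINT \<omega>|M. iexp (u * X \<omega>)) powr c"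
proof -
  obtain \<psi> where "\<And>u. (CLINT \<omega>|M. iexp (u * X \<omega>)) = exp (\<psi> u)"
    "\<And>u. (CLINT \<omega>|M. iexp (u * Z \<omega>)) = exp (of_real c * \<psi> u)"
    using assms unfolding char_power_def by blast
  then show ?thesis
    by (simp only: norm_exp_eq_Re) (simp add: powr_def)
qed

lemma filterlim_dyadic_powr_at_top:
  fixes a :: real
  assumes "a < 0"
  shows "filterlim (\<lambda>n. (1 / 2 ^ n) powr a) at_top sequentially"
proof -
  have "filterlim (\<lambda>n. (- a * ln 2) * real n) at_top sequentially"
    using assms by (intro filterlim_tendsto_pos_mult_at_top[OF tendsto_const] filterlim_real_sequentially)
      (auto simp: mult_neg_pos)
  from filterlim_compose[OF exp_at_top this] show ?thesis
    by (simp add: powr_def ln_div ln_realpow mult_ac)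
qed

section \<open>Lower and upper bounds for the Hoelder exponent of the process\<close>

context dilative_process
begin

lemma holder_bound_bounds:
  assumes "\<delta> \<noteq> 2 * H \<or> H > 1 / 2" "\<delta> \<le> 2 * H"
  shows "0 < holder_bound" "holder_bound \<le> 1"
  using assms H_pos H_le_1 by (auto simp: holder_bound_def)

text \<open>At T = 2^-n, the characteristic function of X(T) / T^H at u has the modulus of that of
  X(1) at w = u / T^(\<delta>/2), raised to the power T^\<delta>, and w^2 T^\<delta> = u^2. A
  Gaussian bound for |w| \<le> \<eta> thus becomes one with the same \<kappa> for |u| \<le> \<eta>
  T^(\<delta>/2), a range that grows to the line when \<delta> < 0.\<close>

lemma char_le_exp:
  assumes "0 \<le> \<delta> \<longrightarrow> has_gaussian_component (distr M borel (X 1))"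
  shows "\<exists>\<kappa> R. 0 < \<kappa> \<and> filterlim R at_top sequentially \<and>
    (\<forall>n u. \<bar>u\<bar> \<le> R n \<longrightarrow> cmod (CLINT \<omega>|M. iexp (u * (X (1 / 2 ^ n) \<omega> / (1 / 2 ^ n) powr H))) \<le> exp (- \<kappa> * u\<^sup>2))"
proof -
  let ?\<phi> = "\<lambda>u. CLINT \<omega>|M. iexp (u * X 1 \<omega>)"
  have scaled: "cmod (CLINT \<omega>|M. iexp (u * (X (1 / 2 ^ n) \<omega> / (1 / 2 ^ n) powr H))) \<le> exp (- \<kappa> * u\<^sup>2)"
    if *: "cmod (?\<phi> (u / (1 / 2 ^ n) powr (\<delta> / 2))) \<le> exp (- \<kappa> * (u / (1 / 2 ^ n) powr (\<delta> / 2))\<^sup>2)" for \<kappa> u n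
  proof -
    define T :: real where "T = 1 / 2 ^ n"
    have T: "0 < T" by (simp add: T_def)
    have eq: "u * (x / T powr H) = u / T powr (\<delta> / 2) * (x / T powr (H - \<delta> / 2))" for x
      using T by (simp add: powr_diff)
    have sq: "(T powr (\<delta> / 2))\<^sup>2 = T powr \<delta>"
      using T by (simp add: powr_power)
    have "cmod (CLINT \<omega>|M. iexp (u * (X T \<omega> / T powr H))) = cmod (?\<phi> (u / T powr (\<delta> / 2))) powr (T powr \<delta>)"
      unfolding eq by (rule char_power_norm[OF scaling[OF T]])
    also have "\<dots> \<le> exp (- \<kappa> * (u / T powr (\<delta> / 2))\<^sup>2) powr (T powr \<delta>)"
      using * by (intro powr_mono2) (auto simp: T_def)
    also have "\<dots> = exp (- \<kappa> * u\<^sup>2)"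
      using T by (simp add: powr_def[of "exp _"] power_divide sq)
    finally show ?thesis unfolding T_def .
  qed
  show ?thesis
  proof (cases "0 \<le> \<delta>")
    case True
    then obtain \<kappa> where \<kappa>: "0 < \<kappa>" "\<And>u. cmod (char (distr M borel (X 1)) u) \<le> exp (- \<kappa> * u\<^sup>2)"
      using has_gaussian_component_char_le assms by blast
    have \<kappa>': "cmod (?\<phi> u) \<le> exp (- \<kappa> * u\<^sup>2)" for u
      unfolding char_distr[OF X1.measurable_X, symmetric] by (rule \<kappa>(2))
    \<comment> \<open>The bound holds for all u, so any diverging range will do.\<close>
    show ?thesis
      by (intro exI[of _ \<kappa>] exI[of _ real] conjI \<kappa>(1) allI impI scaled \<kappa>' filterlim_real_sequentially)
  next
    case False
    obtain \<kappa> \<eta> where \<kappa>: "0 < \<kappa>" "0 < \<eta>" "\<And>u. \<bar>u\<bar> \<le> \<eta> \<Longrightarrow> cmod (?\<phi> u) \<le> exp (- \<kappa> * u\<^sup>2)"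
      using X1.char_le_exp_near_0[OF var_pos] by blast
    show ?thesis
    proof (intro exI[of _ \<kappa>] exI[of _ "\<lambda>n. \<eta> * (1 / 2 ^ n) powr (\<delta> / 2)"] conjI \<kappa>(1) allI impI scaled \<kappa>(3))
      show "filterlim (\<lambda>n. \<eta> * (1 / 2 ^ n) powr (\<delta> / 2)) at_top sequentially"
        using False \<kappa>(2)
        by (intro filterlim_tendsto_pos_mult_at_top[OF tendsto_const] filterlim_dyadic_powr_at_top) auto
      fix n u assume "\<bar>u\<bar> \<le> \<eta> * (1 / 2 ^ n) powr (\<delta> / 2)"
      then show "\<bar>u / (1 / 2 ^ n) powr (\<delta> / 2)\<bar> \<le> \<eta>"
        by (simp add: abs_divide pos_divide_le_eq)
    qed
  qed
qed

text \<open>A bound |X(T)| \<le> C T^\<gamma> at all T = 2^-n confines X(T) / T^H to the ball of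
  radius C T^(\<gamma>-H) for every n, and the probabilities of these small balls tend to 0. The
  countably many exponents H + 1/(j+1) and constants N + 1 dominate all others.\<close>

lemma AE_not_holder_at_0:
  assumes gauss: "0 \<le> \<delta> \<longrightarrow> has_gaussian_component (distr M borel (X 1))"
  shows "AE \<omega> in M. \<forall>\<gamma>>H. \<forall>C. \<exists>n. C * (1 / 2 ^ n) powr \<gamma> < \<bar>X (1 / 2 ^ n) \<omega>\<bar>"
proof -
  obtain \<kappa> R where \<kappa>: "0 < \<kappa>" and R: "filterlim R at_top sequentially"
    and bound: "\<And>n u. \<bar>u\<bar> \<le> R n \<Longrightarrow>
      cmod (CLINT \<omega>|M. iexp (u * (X (1 / 2 ^ n) \<omega> / (1 / 2 ^ n) powr H))) \<le> exp (- \<kappa> * u\<^sup>2)"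
    using char_le_exp[OF gauss] by blast
  have meas [measurable]: "X (1 / 2 ^ n) \<in> borel_measurable M" for n
    by (intro measurable_X) auto
  have not_bounded: "AE \<omega> in M. \<exists>n. (real N + 1) * (1 / 2 ^ n) powr r < \<bar>X (1 / 2 ^ n) \<omega>\<bar>" if r: "H < r" for N r
  proof -
    define E where "E = {\<omega>\<in>space M. \<forall>n. \<bar>X (1 / 2 ^ n) \<omega>\<bar> \<le> (real N + 1) * (1 / 2 ^ n) powr r}"
    have [measurable]: "E \<in> sets M"
      unfolding E_def by measurable
    \<comment> \<open>The reciprocal of the radius (N+1) T^(r-H) of the small ball at T =
      2^-n.\<close>
    define K where "K n = 1 / (real N + 1) * (1 / 2 ^ n) powr (H - r)" for n :: nat
    have "(\<lambda>n. prob {\<omega>\<in>space M. \<bar>X (1 / 2 ^ n) \<omega> / (1 / 2 ^ n) powr H\<bar> \<le> 1 / K n}) \<longlonglongrightarrow> 0"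
    proof (rule small_ball_tendsto_0[OF _ \<kappa> _ R bound])
      show "filterlim K at_top sequentially"
        unfolding K_def using r
        by (intro filterlim_tendsto_pos_mult_at_top[OF tendsto_const] filterlim_dyadic_powr_at_top) auto
    qed measurable
    moreover have "prob E \<le> prob {\<omega>\<in>space M. \<bar>X (1 / 2 ^ n) \<omega> / (1 / 2 ^ n) powr H\<bar> \<le> 1 / K n}" for n
    proof (intro finite_measure_mono subsetI)
      fix \<omega> assume "\<omega> \<in> E"
      then have "\<omega> \<in> space M" "\<bar>X (1 / 2 ^ n) \<omega>\<bar> \<le> (real N + 1) * (1 / 2 ^ n) powr r"
        by (auto simp: E_def)
      then show "\<omega> \<in> {\<omega>\<in>space M. \<bar>X (1 / 2 ^ n) \<omega> / (1 / 2 ^ n) powr H\<bar> \<le> 1 / K n}"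
        by (simp add: K_def abs_divide powr_diff field_simps)
    qed measurable
    ultimately have "prob E \<le> 0"
      by (intro tendsto_lowerbound[where F = sequentially]) auto
    then have "E \<in> null_sets M"
      by (simp add: measure_le_0_iff emeasure_eq_measure null_sets_def)
    then show ?thesis
      by (rule AE_I') (auto simp: E_def not_less)
  qed
  have "AE \<omega> in M. \<forall>N j :: nat. \<exists>n. (real N + 1) * (1 / 2 ^ n) powr (H + 1 / (real j + 1)) < \<bar>X (1 / 2 ^ n) \<omega>\<bar>"
    unfolding AE_all_countable by (intro allI not_bounded) auto
  then show ?thesis
  proof eventually_elim
    case (elim \<omega>)
    show ?case
    proof (intro allI impI)
      fix \<gamma> C :: real assume "H < \<gamma>"
      then obtain j :: nat where j: "1 / (real j + 1) < \<gamma> - H"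
        using reals_Archimedean[of "\<gamma> - H"] by (auto simp: inverse_eq_divide add.commute)
      obtain N :: nat where N: "C < real N"
        using reals_Archimedean2 by blast
      obtain n where n: "(real N + 1) * (1 / 2 ^ n) powr (H + 1 / (real j + 1)) < \<bar>X (1 / 2 ^ n) \<omega>\<bar>"
        using elim by blast
      have "C * (1 / 2 ^ n) powr \<gamma> \<le> (real N + 1) * (1 / 2 ^ n) powr (H + 1 / (real j + 1))"
        using N j by (intro mult_mono powr_mono') auto
      with n show "\<exists>n. C * (1 / 2 ^ n) powr \<gamma> < \<bar>X (1 / 2 ^ n) \<omega>\<bar>"
        by (intro exI[of _ n]) linarith
    qed
  qed
qed

text \<open>The obstruction sits at time 0: with Y(0) = 0, a Hoelder condition on [0,1] would bound
  |X(2^-n)| by C 2^(-n \<gamma>).\<close>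

lemma AE_local_holder_exponent_le:
  assumes gauss: "0 \<le> \<delta> \<longrightarrow> has_gaussian_component (distr M borel (X 1))"
    and Y: "continuous_modification M X Y"
  shows "AE \<omega> in M. local_holder_exponent {0..} (\<lambda>t. Y t \<omega>) \<le> H"
proof -
  have "AE \<omega> in M. \<forall>n. Y (1 / 2 ^ n) \<omega> = X (1 / 2 ^ n) \<omega>"
    unfolding AE_all_countable using Y by (auto simp: continuous_modification_def)
  moreover have "AE \<omega> in M. Y 0 \<omega> = X 0 \<omega>"
    using Y by (auto simp: continuous_modification_def)
  ultimately show ?thesis
    using AE_not_holder_at_0[OF gauss] start
  proof eventually_elim
    case (elim \<omega>)
    show ?case
    proof (rule local_holder_exponent_le)
      fix \<gamma> assume \<gamma>: "H < \<gamma>"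
      show "\<not> locally_holder_on {0..} \<gamma> (\<lambda>t. Y t \<omega>)"
      proof
        assume "locally_holder_on {0..} \<gamma> (\<lambda>t. Y t \<omega>)"
        then obtain C where C: "\<And>s t. s \<in> {0..1} \<Longrightarrow> t \<in> {0..1} \<Longrightarrow> \<bar>Y t \<omega> - Y s \<omega>\<bar> \<le> C * \<bar>t - s\<bar> powr \<gamma>"
          by (rule locally_holder_onD[of _ _ _ "{0..1}"]) auto
        obtain n where "C * (1 / 2 ^ n) powr \<gamma> < \<bar>X (1 / 2 ^ n) \<omega>\<bar>"
          using elim \<gamma> by blast
        moreover have "(1 / 2 ^ n :: real) \<in> {0..1}"
          by simp
        ultimately show False
          using C[of 0 "1 / 2 ^ n"] elim by simp
      qed
    qed (use H_pos in simp)
  qed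
qed

lemma ex_holder_modification:
  assumes "\<delta> \<noteq> 2 * H \<or> H > 1 / 2" "\<delta> \<le> 2 * H"
  shows "\<exists>Y. continuous_modification M X Y \<and>
    (\<forall>\<omega>\<in>space M. \<forall>\<gamma>\<in>{0<..<holder_bound}. locally_holder_on {0..} \<gamma> (\<lambda>t. Y t \<omega>))"
  using holder_bound_bounds[OF assms] ex_increment_moments[OF assms] measurable_X
  by (intro kolmogorov_chentsov prob_space_axioms)

lemma AE_local_holder_exponent_ge:
  assumes "\<delta> \<noteq> 2 * H \<or> H > 1 / 2" "\<delta> \<le> 2 * H"
    and Y: "continuous_modification M X Y"
  shows "AE \<omega> in M. holder_bound \<le> local_holder_exponent {0..} (\<lambda>t. Y t \<omega>)"
proof -
  obtain Y' where Y': "continuous_modification M X Y'"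
    and holder: "\<And>\<omega> \<gamma>. \<omega> \<in> space M \<Longrightarrow> \<gamma> \<in> {0<..<holder_bound} \<Longrightarrow> locally_holder_on {0..} \<gamma> (\<lambda>t. Y' t \<omega>)"
    using ex_holder_modification[OF assms(1,2)] by blast
  show ?thesis
    using continuous_modification_unique[OF Y Y'] AE_space
  proof eventually_elim
    case (elim \<omega>)
    have "locally_holder_on {0..} \<gamma> (\<lambda>t. Y t \<omega>)" if "\<gamma> \<in> {0<..<holder_bound}" for \<gamma>
      using locally_holder_on_cong[of "{0..}" "\<lambda>t. Y t \<omega>" "\<lambda>t. Y' t \<omega>"] holder[OF elim(2) that] elim(1)
      by simp
    then show ?case
      by (intro local_holder_exponent_ge holder_bound_bounds[OF assms(1,2)])
  qed
qed

end

theorem theorem2p7: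
  fixes M :: "'a measure" and X :: "real \<Rightarrow> 'a \<Rightarrow> real" and H \<delta> :: real
  assumes "dilatively_stable H \<delta> M X"
    and "stationary_increments M X"
    and "zero_mean M X"
    and "\<delta> \<noteq> 2 * H \<or> H > 1 / 2"
  shows "(\<exists>Y. continuous_modification M X Y \<and>
            (\<forall>\<omega>\<in>space M.
               (\<delta> < 0 \<longrightarrow>
                  (\<forall>\<gamma>\<in>{0<..<H}. locally_holder_on {0..} \<gamma> (\<lambda>t. Y t \<omega>))) \<and>
               (0 \<le> \<delta> \<and> \<delta> < 2 * H \<longrightarrow>
                  (\<forall>\<gamma>\<in>{0<..<H - \<delta> / 2}. locally_holder_on {0..} \<gamma> (\<lambda>t. Y t \<omega>))) \<and>
               (\<delta> = 2 * H \<and> H > 1 / 2 \<longrightarrow>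
                  (\<forall>\<gamma>\<in>{0<..<H - 1 / 2}. locally_holder_on {0..} \<gamma> (\<lambda>t. Y t \<omega>))))) \<and>
         ((\<delta> \<ge> 0 \<longrightarrow> has_gaussian_component (distr M borel (X 1))) \<longrightarrow>
            (\<forall>Y. continuous_modification M X Y \<longrightarrow>
               (\<delta> < 0 \<longrightarrow>
                  (AE \<omega> in M. local_holder_exponent {0..} (\<lambda>t. Y t \<omega>) = H)) \<and>
               (0 \<le> \<delta> \<and> \<delta> < 2 * H \<longrightarrow>
                  (AE \<omega> in M. local_holder_exponent {0..} (\<lambda>t. Y t \<omega>) \<in> {H - \<delta> / 2..H})) \<and>
               (\<delta> = 2 * H \<and> H > 1 / 2 \<longrightarrow>
                  (AE \<omega> in M. local_holder_exponent {0..} (\<lambda>t. Y t \<omega>) \<in> {H - 1 / 2..H}))))"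
proof (intro conjI impI allI)
  interpret dilative_process M X H \<delta>
    using assms(1-3) by (rule dilative_processI)
  have \<delta>: "\<delta> \<le> 2 * H"
    using assms(1) by (simp add: dilatively_stable_def)
  have bound: "\<delta> < 0 \<Longrightarrow> holder_bound = H" "0 \<le> \<delta> \<Longrightarrow> \<delta> < 2 * H \<Longrightarrow> holder_bound = H - \<delta> / 2"
    "\<delta> = 2 * H \<Longrightarrow> holder_bound = H - 1 / 2"
    using H_pos unfolding holder_bound_def by auto
  show "\<exists>Y. continuous_modification M X Y \<and>
            (\<forall>\<omega>\<in>space M.
               (\<delta> < 0 \<longrightarrow>
                  (\<forall>\<gamma>\<in>{0<..<H}. locally_holder_on {0..} \<gamma> (\<lambda>t. Y t \<omega>))) \<and>
               (0 \<le> \<delta> \<and> \<delta> < 2 * H \<longrightarrow>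
                  (\<forall>\<gamma>\<in>{0<..<H - \<delta> / 2}. locally_holder_on {0..} \<gamma> (\<lambda>t. Y t \<omega>))) \<and>
               (\<delta> = 2 * H \<and> H > 1 / 2 \<longrightarrow>
                  (\<forall>\<gamma>\<in>{0<..<H - 1 / 2}. locally_holder_on {0..} \<gamma> (\<lambda>t. Y t \<omega>))))"
    using ex_holder_modification[OF assms(4) \<delta>] bound by metis
  fix Y
  assume gauss: "\<delta> \<ge> 0 \<longrightarrow> has_gaussian_component (distr M borel (X 1))"
    and Y: "continuous_modification M X Y"
  \<comment> \<open>For \<delta> < 0 this interval collapses to the point H, which gives the
    equality in the first case.\<close>
  have exponent: "AE \<omega> in M. local_holder_exponent {0..} (\<lambda>t. Y t \<omega>) \<in> {holder_bound..H}"
    using AE_local_holder_exponent_le[OF gauss Y] AE_local_holder_exponent_ge[OF assms(4) \<delta> Y]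
    by eventually_elim simp
  show "AE \<omega> in M. local_holder_exponent {0..} (\<lambda>t. Y t \<omega>) = H" if "\<delta> < 0"
    using exponent bound(1)[OF that] by simp
  show "AE \<omega> in M. local_holder_exponent {0..} (\<lambda>t. Y t \<omega>) \<in> {H - \<delta> / 2..H}" if "0 \<le> \<delta> \<and> \<delta> < 2 * H"
    using exponent bound(2) that by simp
  show "AE \<omega> in M. local_holder_exponent {0..} (\<lambda>t. Y t \<omega>) \<in> {H - 1 / 2..H}" if "\<delta> = 2 * H \<and> H > 1 / 2"
    using exponent bound(3) that by simp
qed

end
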